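(* For every $t\in\mathbb{N}$, there is an isolation scheme for Hamiltonian cycles in graphs of treewidth at most $t$ that uses $\mathcal{O}(t\log n+\log^2 n)$ random bits and assigns weights upper bounded by $2^{\mathcal{O}(t\log n+\log^2 n)}$ (where $n$ is the number of vertices and the constants in the $\mathcal{O}$-notation do not depend on $t$).
   Context: For a weight function $\omega\colon U\to\mathbb{N}$ and $X\subseteq U$, $\omega(X)=\sum_{e\in X}\omega(e)$; $\omega$ isolates $\mathcal{F}\subseteq 2^U$ if exactly one member of $\mathcal{F}$ attains the minimum weight. $\mathsf{HC}(G)$ is the family of edge sets of Hamiltonian cycles of $G$. An isolation scheme for Hamiltonian cycles on a graph class $\mathcal{C}$ is, for every $n$ and $m$, a list of weight functions $\omega_1,\ldots,\omega_\ell\colon[m]\to\mathbb{N}$ such that for every $n$-vertex graph $G\in\mathcal{C}$ with edge set identified with $[m]$, at least half of the $\omega_i$ isolate $\mathsf{HC}(G)$. It uses $\log\ell$ random bits; its maximum weight is the maximum value of the $\omega_i$.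
   Formalization: The requirement that at least half of the weight functions isolate HC(G) is imposed only on graphs having a Hamiltonian cycle, since no weight function isolates an empty family; bounds are stated for n ≥ 1, and vertices of the finite graphs are natural numbers. *)

theory Defs
  imports Complex_Main
begin

section \<open>Finite simple graphs\<close>

definition simple_graph :: "'a set \<Rightarrow> 'a set set \<Rightarrow> bool" where
  "simple_graph V E \<longleftrightarrow> finite V \<and> (\<forall>e\<in>E. e \<subseteq> V \<and> card e = 2)"

definition cycle_edges :: "'a list \<Rightarrow> 'a set set" where
  "cycle_edges vs = {{vs ! i, vs ! (Suc i mod length vs)} | i. i < length vs}"

text \<open>A cycle is given by a cyclic ordering of its vertices; different lists may describe the
  same cycle.\<close>

definition is_cycle :: "'a set \<Rightarrow> 'a set set \<Rightarrow> 'a list \<Rightarrow> bool" where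
  "is_cycle V E vs \<longleftrightarrow>
     3 \<le> length vs \<and> distinct vs \<and> set vs \<subseteq> V \<and> cycle_edges vs \<subseteq> E"

definition HC :: "'a set \<Rightarrow> 'a set set \<Rightarrow> 'a set set set" where
  "HC V E = {cycle_edges vs | vs. is_cycle V E vs \<and> set vs = V}"

definition connected_graph :: "'a set \<Rightarrow> 'a set set \<Rightarrow> bool" where
  "connected_graph V E \<longleftrightarrow>
     V \<noteq> {} \<and> (\<forall>u\<in>V. \<forall>v\<in>V. (u, v) \<in> {(x, y). {x, y} \<in> E}\<^sup>*)"

definition is_tree :: "'a set \<Rightarrow> 'a set set \<Rightarrow> bool" where
  "is_tree V E \<longleftrightarrow> simple_graph V E \<and> connected_graph V E \<and> (\<nexists>vs. is_cycle V E vs)"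

section \<open>Treewidth\<close>

text \<open>The connectivity condition for \<open>v\<close> includes that \<open>v\<close> occurs in some bag, because
  \<^const>\<open>connected_graph\<close> requires a nonempty vertex set.\<close>

definition tree_decomposition ::
  "'a set \<Rightarrow> 'a set set \<Rightarrow> 'b set \<Rightarrow> 'b set set \<Rightarrow> ('b \<Rightarrow> 'a set) \<Rightarrow> bool" where
  "tree_decomposition V E I F bag \<longleftrightarrow>
     is_tree I F \<and>
     (\<forall>x\<in>I. bag x \<subseteq> V) \<and>
     (\<forall>v\<in>V. let X = {x \<in> I. v \<in> bag x} in connected_graph X {e \<in> F. e \<subseteq> X}) \<and>
     (\<forall>e\<in>E. \<exists>x\<in>I. e \<subseteq> bag x)"

definition decomposition_width :: "'b set \<Rightarrow> ('b \<Rightarrow> 'a set) \<Rightarrow> nat" where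
  "decomposition_width I bag = Max ((\<lambda>x. card (bag x)) ` I) - 1"

text \<open>Decomposition trees are finite, so their nodes may be taken to be natural numbers. Every
  finite simple graph has a tree decomposition (with a single bag), so the minimum exists. The
  graph without vertices gets treewidth 0 here.\<close>

definition treewidth :: "'a set \<Rightarrow> 'a set set \<Rightarrow> nat" where
  "treewidth V E =
     (LEAST k. \<exists>(I :: nat set) F bag.
        tree_decomposition V E I F bag \<and> decomposition_width I bag = k)"

section \<open>Isolation schemes\<close>

definition isolates :: "('e \<Rightarrow> nat) \<Rightarrow> 'e set set \<Rightarrow> bool" where
  "isolates \<omega> \<F> \<longleftrightarrow> (\<exists>!X. X \<in> \<F> \<and> (\<forall>Y\<in>\<F>. sum \<omega> X \<le> sum \<omega> Y))"

text \<open>A scheme \<open>W\<close> assigns to \<open>n\<close> and \<open>m\<close> a nonempty list of weight functions on \<open>{1..m}\<close>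
  (values outside \<open>{1..m}\<close> are irrelevant). It has to work for every bijection \<open>\<phi>\<close> between the
  edge set and \<open>{1..m}\<close>. No weight function isolates an empty family, so the requirement is
  imposed only on graphs having a Hamiltonian cycle. Graphs are finite, so their vertices may be
  taken to be natural numbers.\<close>

definition isolation_scheme_HC ::
  "(nat set \<Rightarrow> nat set set \<Rightarrow> bool) \<Rightarrow> (nat \<Rightarrow> nat \<Rightarrow> (nat \<Rightarrow> nat) list) \<Rightarrow> bool" where
  "isolation_scheme_HC \<C> W \<longleftrightarrow>
     (\<forall>n m. W n m \<noteq> [] \<and>
        (\<forall>V E \<phi>. simple_graph V E \<longrightarrow> \<C> V E \<longrightarrow> card V = n \<longrightarrow> bij_betw \<phi> E {1..m} \<longrightarrow>
           HC V E \<noteq> {} \<longrightarrow>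
           length (W n m) \<le> 2 * length (filter (\<lambda>\<omega>. isolates (\<omega> \<circ> \<phi>) (HC V E)) (W n m))))"

definition random_bits :: "'w list \<Rightarrow> real" where
  "random_bits ws = log 2 (length ws)"

end

(* Split the edge set recursively, along balanced bags of a tree decomposition, into pieces with
   boundaries of O(t) vertices; O(log n) levels suffice. Weights are built bottom-up: at each level,
   the old weights are scaled up and the hash 2^e mod p of the edge number e, for a fresh random
   prime p, is added as a tie-breaker. The invariant is that every choice of edges outside a piece has
   at most one lightest completion inside the piece. Ordered by weight, these lightest completions
   give a triangular submatrix of the compatibility matrix. Once the degrees on the boundary are fixed
   (3^b choices), compatibility means connectedness, i.e. an odd number of two-colourings constant on
   components, and counting these via the colours of the boundary shows that the matrix has rank at
   most 2^b over GF(2). So a piece has at most 6^b = 2^O(t) lightest completions, a merge of two pieces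
   has 2^O(t) candidates, and a random prime with O(t + log n) bits separates the hashes of all
   candidates at a level with high probability. *)

theory Submission
  imports Defs "HOL-Library.Nat_Bijection" "HOL-Library.FuncSet" "HOL-Computational_Algebra.Primes"
begin

text \<open>The weights must be fixed before the graph is seen, so the tree decomposition appears
  only in the analysis: a weight depends on the edge number and the drawn primes alone, and the
  splitting enters merely through the number of levels and the size of the primes. For the same
  reason one prime has to suit all pieces of its level at once; this is affordable because a level
  has polynomially many pieces. Each level costs random bits in proportion to the boundary size.
  Splitting for balanced edge numbers alone would let the boundary gain a bag per level and lose a
  factor log n in the term with t, so splits that balance the edges alternate with splits that
  balance the boundary. Completions are compared for every outside choice, since a merge turns the
  other piece into part of the outside; the price, exponentially many outside choices, is paid by
  the rank bound. With L levels, each may fail with probability at most 1/(2L), so at least half of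
  all lists of primes survive.\<close>

section \<open>Primes and hashing\<close>

text \<open>Nair's argument: in the Leibniz harmonic triangle, the reciprocals of \<open>k * (n choose k)\<close>
  are integer combinations of \<open>1, 1/2, \<dots>, 1/n\<close>.\<close>

lemma times_binomial_dvd:
  fixes l :: nat
  assumes "\<And>i. 1 \<le> i \<Longrightarrow> i \<le> n \<Longrightarrow> i dvd l" and "1 \<le> k" "k \<le> n"
  shows "k * (n choose k) dvd l"
proof -
  have "\<exists>z::int. real l = real_of_int z * real (k * (n choose k))"
    using assms(2,3,1)
  proof (induction k arbitrary: n rule: dec_induct)
    case base
    then obtain z where "l = n * z" by (meson dvdE le_refl)
    then have "real l = real_of_int (int z) * real (1 * (n choose 1))" by simp
    then show ?case by blast
  next
    case (step k)
    obtain n' where n': "n = Suc n'" using step.prems(1) by (cases n) auto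
    have kn: "k \<le> n'" "1 \<le> k" using step n' by auto
    obtain z1 where z1: "real l = real_of_int z1 * real (k * (n' choose k))"
      using step.IH[of n'] step.prems kn n' by auto
    obtain z2 where z2: "real l = real_of_int z2 * real (k * (n choose k))"
      using step.IH[of n] step.prems kn n' by auto
    define a b c where "a = real (n' choose k)" "b = real (n choose k)" "c = real (n choose Suc k)"
    have pos: "a > 0" "b > 0" "c > 0" using kn n' step.prems by (auto simp: a_b_c_def zero_less_binomial_iff simp del: binomial_Suc_Suc)
    have bb: "b = a * real (Suc n') / real (Suc n' - k)"
    proof -
      have "(Suc n' - k) * (Suc n' choose k) = Suc n' * (n' choose k)"
        using binomial_absorb_comp[of "Suc n'" k] by simp
      then have "real (Suc n' - k) * b = real (Suc n') * a"
        unfolding a_b_c_def n' by (metis of_nat_mult)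
      then show ?thesis using kn by (simp add: field_simps)
    qed
    have cc: "real (Suc k) * c = real (Suc n') * a"
      unfolding a_b_c_def n' using Suc_times_binomial[of k n'] by (metis of_nat_mult)
    have "real l * (1 / (k * a) - 1 / (k * b)) = z1 - z2"
      using z1 z2 pos kn by (simp add: a_b_c_def field_simps)
    \<comment> \<open>This is the recurrence of the Leibniz triangle. As \<open>l\<close> times
      either reciprocal on the left is an integer, so is \<open>l\<close> times the one on the
      right.\<close>
    moreover have "1 / (k * a) - 1 / (k * b) = 1 / (real (Suc k) * c)"
    proof -
      define N where "N = real (Suc n')"
      have N: "real (Suc n' - k) = N - real k" "N > real k" using kn by (auto simp: N_def of_nat_diff)
      show ?thesis
        unfolding cc bb N N_def[symmetric] using pos kn N(2)
        by (simp add: divide_simps)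
    qed
    ultimately have "real l / (real (Suc k) * c) = z1 - z2" by simp
    then have "real l = (z1 - z2) * (real (Suc k) * c)"
      using pos by (simp add: divide_eq_eq)
    then have "real l = real_of_int (z1 - z2) * real (Suc k * (n choose Suc k))"
      unfolding a_b_c_def by (simp only: of_nat_mult of_int_diff)
    then show ?case by blast
  qed
  then obtain z :: int where "real l = real_of_int z * real (k * (n choose k))" by blast
  then have "int l = z * int (k * (n choose k))"
    by (metis of_int_eq_iff of_int_mult of_int_of_nat_eq)
  then show ?thesis by (metis dvd_triv_right of_nat_dvd_iff)
qed

text \<open>The witness is the least common multiple of 1, ..., \<open>M\<close>, written as the
  product over all primes of their largest powers up to \<open>M\<close>; every factor is at most
  \<open>M\<close>.\<close>

lemma common_multiple_le_power_prime_count: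
  fixes M :: nat
  assumes "M \<ge> 1"
  obtains l where "l > 0" "\<And>i. 1 \<le> i \<Longrightarrow> i \<le> M \<Longrightarrow> i dvd l"
    "l \<le> M ^ card {p. prime p \<and> p \<le> M}"
proof -
  define P where "P = {p. prime p \<and> p \<le> M}"
  define ex where "ex p = Max {k. p ^ k \<le> M}" for p :: nat
  define l where "l = (\<Prod>p\<in>P. p ^ ex p)"
  have finP: "finite P" unfolding P_def by (rule finite_subset[of _ "{..M}"]) auto
  have fin: "finite {k. p ^ k \<le> M}" if "prime p" for p
  proof (rule finite_subset)
    show "{k. p ^ k \<le> M} \<subseteq> {..M}"
    proof safe
      fix k assume "p ^ k \<le> M"
      moreover have "k < p ^ k" using that prime_ge_2_nat[OF that] by (intro power_gt_expt) auto
      ultimately show "k \<le> M" by simp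
    qed
  qed simp
  have pe: "p ^ ex p \<le> M" if "prime p" for p
    proof -
    have "0 \<in> {k. p ^ k \<le> M}" using assms by simp
    then have "Max {k. p ^ k \<le> M} \<in> {k. p ^ k \<le> M}" using fin[OF that] by (metis Max_in empty_iff)
    then show ?thesis unfolding ex_def by simp
  qed
  have l0: "l > 0" unfolding l_def P_def by (intro prod_pos) (auto dest: prime_gt_0_nat)
  have "i dvd l" if i: "1 \<le> i" "i \<le> M" for i
  proof -
    have pf: "prime_factors i \<subseteq> P"
      using i by (auto simp: P_def prime_factors_dvd dest!: dvd_imp_le)
    have "i = (\<Prod>p\<in>prime_factors i. p ^ multiplicity p i)"
      using i prod_prime_factors[of i] by simp
    also have "\<dots> dvd (\<Prod>p\<in>prime_factors i. p ^ ex p)"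
    proof (intro prod_dvd_prod le_imp_power_dvd)
      fix p assume p: "p \<in> prime_factors i"
      then have pp: "prime p" by auto
      have "p ^ multiplicity p i \<le> M"
        using i multiplicity_dvd[of p i] by (meson dvd_imp_le le_trans less_le_trans zero_less_one)
      then show "multiplicity p i \<le> ex p"
        unfolding ex_def using fin[OF pp] by (intro Max_ge) auto
    qed
    also have "\<dots> dvd l" unfolding l_def using finP pf by (intro prod_dvd_prod_subset) auto
    finally show ?thesis .
  qed
  moreover have "l \<le> M ^ card P"
  proof -
    have "l \<le> (\<Prod>p\<in>P. M)" unfolding l_def using pe by (intro prod_mono) (auto simp: P_def)
    then show ?thesis by simp
  qed
  ultimately show ?thesis using that l0 unfolding P_def by blast
qed

text \<open>For \<open>M = 2 * n\<close> the number \<open>n * (2 * n choose n)\<close>, which is at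
  least \<open>4 ^ n / 2\<close>, divides a common multiple bounded by \<open>M ^ c\<close>, with
  \<open>c\<close> the number of primes up to \<open>M\<close>. Fewer than \<open>2 ^ s\<close>
  primes would make this power too small. Reaching only the square root of the range costs no more
  than a factor 2 in the number of random bits.\<close>

lemma card_primes_ge:
  assumes "s \<ge> 3"
  shows "2 ^ s \<le> card {p::nat. prime p \<and> p \<le> 2 ^ (2 * s)}"
proof (rule ccontr)
  define M n :: nat where "M = 2 ^ (2 * s)" and "n = 2 ^ (2 * s - 1)"
  have M: "M = 2 * n" "n \<ge> 1" using assms unfolding M_def n_def
    by (auto simp: power_Suc[symmetric] simp del: power_Suc)
  define c where "c = card {p::nat. prime p \<and> p \<le> M}"
  assume "\<not> ?thesis"
  then have c: "c \<le> 2 ^ s - 1" unfolding c_def M_def by simp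
  obtain l where l: "l > 0" "\<And>i. 1 \<le> i \<Longrightarrow> i \<le> M \<Longrightarrow> i dvd l" "l \<le> M ^ c"
    using common_multiple_le_power_prime_count[of M] M unfolding c_def by auto
  have "n * (2 * n choose n) \<le> l"
    using times_binomial_dvd[of M l n] l M by (intro dvd_imp_le) auto
  moreover have "4 ^ n \<le> 2 * (n * real (2 * n choose n))"
    using central_binomial_lower_bound[of n] M by (simp add: field_simps)
  ultimately have "4 ^ n \<le> 2 * real l" 
    by (smt (verit) of_nat_le_iff of_nat_mult)
  then have "(4::nat) ^ n \<le> 2 * l"
    by (metis of_nat_le_iff of_nat_mult of_nat_numeral of_nat_power)
  also have "\<dots> \<le> 2 * M ^ c" using l by simp
  also have "\<dots> = 2 ^ (Suc (2 * s * c))" unfolding M_def by (simp add: power_mult)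
  finally have "(2::nat) ^ (2 * n) \<le> 2 ^ (Suc (2 * s * c))" by (simp add: power_mult)
  then have "2 * n \<le> Suc (2 * s * c)" 
    using power_increasing_iff[of "2::nat" "2 * n" "Suc (2 * s * c)"] by (simp del: power_Suc)
  then have "M \<le> Suc (2 * s * c)" using M by simp
  also have "\<dots> \<le> Suc (2 * s * (2 ^ s - 1))" using c by simp
  also have "\<dots> \<le> 2 * s * 2 ^ s - 5" 
  proof -
    have "2 * s * (2 ^ s - 1) = 2 * s * 2 ^ s - 2 * s" by (simp add: diff_mult_distrib2)
    moreover have "2 * s \<le> 2 * s * 2 ^ s" by simp
    ultimately show ?thesis using assms by linarith
  qed
  also have "\<dots> < 2 ^ s * 2 ^ s"
  proof -
    have "2 * s \<le> 2 ^ s" using assms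
    proof (induction s rule: nat_induct_at_least)
      case base show ?case by simp
    next
      case (Suc k) then show ?case by simp
    qed
    then have "2 * s * 2 ^ s \<le> 2 ^ s * 2 ^ s" by simp
    moreover have "(0::nat) < 2 ^ s * 2 ^ s" by simp
    ultimately show ?thesis by linarith
  qed
  finally show False unfolding M_def by (simp add: power_add mult_2)
qed

section \<open>Collisions of hashes modulo a prime\<close>

lemma card_prime_divisors_le:
  fixes D :: nat
  assumes "D > 0" "D < 2 ^ m" and P: "finite P" "\<And>p. p \<in> P \<Longrightarrow> prime p"
  shows "card {p\<in>P. p dvd D} \<le> m"
proof -
  define S where "S = {p\<in>P. p dvd D}"
  have S: "finite S" "\<And>p. p \<in> S \<Longrightarrow> prime p" "\<And>p. p \<in> S \<Longrightarrow> p dvd D" using P unfolding S_def by auto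
  have "(2::nat) ^ card S = (\<Prod>p\<in>S. 2)" by simp
  also have "\<dots> \<le> \<Prod>S" using S by (intro prod_mono) (auto dest: prime_ge_2_nat)
  also have "\<Prod>S dvd D"
    using S
  proof (induction S rule: finite_induct)
    case (insert p S)
    have "coprime p (\<Prod>S)"
      using insert.prems insert.hyps by (intro prod_coprime_right) (metis insertCI primes_coprime)
    then show ?case using insert by (simp add: divides_mult)
  qed simp
  then have "\<Prod>S \<le> D" using assms by (intro dvd_imp_le) auto
  finally have "(2::nat) ^ card S < 2 ^ m" using assms by linarith
  then show ?thesis unfolding S_def by simp
qed

text \<open>Without reduction, the sum of the \<open>2 ^ \<phi> e\<close> is the binary code of the
  edge set, so different sets have different sums. A collision modulo \<open>p\<close> makes
  \<open>p\<close> divide their nonzero difference, which is below \<open>2 ^ Suc m\<close> and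
  hence has at most \<open>Suc m\<close> prime divisors.\<close>

lemma card_colliding_primes_le:
  fixes \<phi> :: "'a \<Rightarrow> nat" and P :: "nat set"
  assumes "finite E" and \<phi>: "inj_on \<phi> E" "\<phi> ` E \<subseteq> {..m}" and XY: "X \<subseteq> E" "Y \<subseteq> E" "X \<noteq> Y"
    and P: "finite P" "\<And>p. p \<in> P \<Longrightarrow> prime p"
  shows "card {p\<in>P. (\<Sum>e\<in>X. 2 ^ \<phi> e mod p) = (\<Sum>e\<in>Y. 2 ^ \<phi> e mod p)} \<le> Suc m"
proof -
  define a where "a Z = (\<Sum>e\<in>Z. (2::nat) ^ \<phi> e)" for Z
  have enc: "a Z = set_encode (\<phi> ` Z)" if "Z \<subseteq> E" for Z
    using that \<phi>(1) unfolding a_def set_encode_def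
    by (simp add: sum.reindex inj_on_subset)
  have lt: "a Z < 2 ^ Suc m" if "Z \<subseteq> E" for Z
  proof -
    have "a Z \<le> (\<Sum>i\<in>{..m}. 2 ^ i)"
      unfolding enc[OF that] set_encode_def using that \<phi> by (intro sum_mono2) auto
    also have "\<dots> < 2 ^ Suc m"
    proof -
      have "{..m} = {q. q < Suc m}" by auto
      then have "(\<Sum>i\<in>{..m}. (2::nat) ^ i) = 2 ^ Suc m - 1"
        using mask_eq_sum_exp_nat[of "Suc m"] by (simp del: power_Suc)
      then show ?thesis by simp
    qed
    finally show ?thesis .
  qed
  have fin: "finite (\<phi> ` X)" "finite (\<phi> ` Y)" using assms(1) XY by (meson finite_imageI finite_subset)+
  have ne: "a X \<noteq> a Y"
    unfolding enc[OF XY(1)] enc[OF XY(2)] set_encode_eq[OF fin]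
    using inj_on_image_eq_iff[OF \<phi>(1) XY(1,2)] XY(3) by simp
  define D where "D = nat \<bar>int (a X) - int (a Y)\<bar>"
  have D: "D > 0" "D < 2 ^ Suc m" using ne lt[OF XY(1)] lt[OF XY(2)] unfolding D_def by linarith+
  have "p dvd D" if "(\<Sum>e\<in>X. 2 ^ \<phi> e mod p) = (\<Sum>e\<in>Y. 2 ^ \<phi> e mod p)" for p :: nat
  proof -
    have "a X mod p = a Y mod p" unfolding a_def using that by (metis mod_sum_eq)
    then have "int (a X) mod int p = int (a Y) mod int p" by (metis zmod_int)
    then have "int p dvd int (a X) - int (a Y)" by (simp add: mod_eq_dvd_iff)
    then show ?thesis unfolding D_def by (metis dvd_abs_iff int_dvd_int_iff int_nat_eq abs_ge_zero)
  qed
  then have "card {p\<in>P. (\<Sum>e\<in>X. 2 ^ \<phi> e mod p) = (\<Sum>e\<in>Y. 2 ^ \<phi> e mod p)} \<le> card {p\<in>P. p dvd D}"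
    using P by (intro card_mono) auto
  then show ?thesis using card_prime_divisors_le[OF D P] by simp
qed

section \<open>Counting\<close>

text \<open>The counting form of multiplying conditional success probabilities: a good list keeps at
  least \<open>card A - \<beta>\<close> good extensions. Lists grow at the head because
  \<open>hash_weight\<close> takes the head as the latest prime.\<close>

lemma card_good_lists_ge:
  fixes Q :: "'a list \<Rightarrow> bool"
  assumes "finite A" "Q []"
    and step: "\<And>xs. length xs < L \<Longrightarrow> set xs \<subseteq> A \<Longrightarrow> Q xs \<Longrightarrow> card {x\<in>A. \<not> Q (x # xs)} \<le> \<beta>"
  shows "n \<le> L \<Longrightarrow> (card A - \<beta>) ^ n \<le> card {xs. set xs \<subseteq> A \<and> length xs = n \<and> Q xs}"
proof (induction n)
  case 0
  have "{xs. set xs \<subseteq> A \<and> length xs = 0 \<and> Q xs} = {[]}" using assms by auto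
  then show ?case by simp
next
  case (Suc n)
  define G where "G n = {xs. set xs \<subseteq> A \<and> length xs = n \<and> Q xs}" for n
  have finG: "finite (G n)" for n
    unfolding G_def using finite_lists_length_eq[OF assms(1), of n] by (rule rev_finite_subset) auto
  define S where "S = (SIGMA xs:G n. {x\<in>A. Q (x # xs)})"
  have "(card A - \<beta>) ^ Suc n \<le> card (G n) * (card A - \<beta>)"
    using Suc by (simp add: G_def mult.commute)
  also have "\<dots> = (\<Sum>xs\<in>G n. card A - \<beta>)" by simp
  also have "\<dots> \<le> (\<Sum>xs\<in>G n. card {x\<in>A. Q (x # xs)})"
  proof (intro sum_mono)
    fix xs assume xs: "xs \<in> G n"
    have "{x\<in>A. Q (x # xs)} = A - {x\<in>A. \<not> Q (x # xs)}" by auto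
    then have "card {x\<in>A. Q (x # xs)} = card A - card {x\<in>A. \<not> Q (x # xs)}"
      using assms(1) by (simp add: card_Diff_subset)
    then show "card A - \<beta> \<le> card {x\<in>A. Q (x # xs)}"
      using step[of xs] xs Suc.prems unfolding G_def by auto
  qed
  also have "\<dots> = card S" unfolding S_def using finG assms(1) by (simp add: card_SigmaI)
  also have "\<dots> = card ((\<lambda>(xs, x). x # xs) ` S)"
    by (intro card_image[symmetric]) (auto simp: inj_on_def)
  also have "\<dots> \<le> card (G (Suc n))"
    by (intro card_mono finG) (auto simp: S_def G_def)
  finally show ?case unfolding G_def .
qed

text \<open>Bernoulli's inequality: \<open>L\<close> steps that each fail with probability at most
  1/(2L) all succeed with probability at least 1/2.\<close>

lemma half_power_le_power_diff:
  fixes N \<beta> L :: nat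
  assumes "2 * L * \<beta> \<le> N"
  shows "N ^ L \<le> 2 * (N - \<beta>) ^ L"
proof (cases "L = 0 \<or> N = 0")
  case True then show ?thesis using assms by (cases "L = 0") auto
next
  case False
  then have L: "L > 0" "N > 0" by auto
  have "\<beta> \<le> N" using assms L by (metis (no_types) le_trans mult_le_mono1 mult_1 One_nat_def Suc_leI mult_pos_pos pos2)
  define x where "x = - real \<beta> / real N"
  have "x \<ge> -1" unfolding x_def using L \<open>\<beta> \<le> N\<close> by (simp add: field_simps)
  have "1 + real L * x \<le> (1 + x) ^ L" using Bernoulli_inequality[OF \<open>x \<ge> -1\<close>] by simp
  moreover have "1/2 \<le> 1 + real L * x"
  proof -
    have "real (2 * L * \<beta>) \<le> real N" using assms by (simp only: of_nat_le_iff)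
    then show ?thesis unfolding x_def using L by (simp add: field_simps)
  qed
  ultimately have "1/2 \<le> (1 + x) ^ L" by linarith
  then have "1 * real N ^ L \<le> (2 * (1 + x) ^ L) * real N ^ L"
    by (intro mult_right_mono) auto
  then have "real N ^ L \<le> 2 * ((1 + x) * real N) ^ L"
    by (simp add: power_mult_distrib)
  also have "(1 + x) * real N = real (N - \<beta>)"
    unfolding x_def using L \<open>\<beta> \<le> N\<close> by (simp add: field_simps of_nat_diff)
  finally have "real (N ^ L) \<le> real (2 * (N - \<beta>) ^ L)" by simp
  then show ?thesis by (simp only: of_nat_le_iff)
qed

text \<open>The matrix \<open>(x, y) \<mapsto> \<Sum>s\<in>T. f y s * g x s\<close> has rank at most \<open>card T\<close> over the field with two
  elements, and it is triangular when ordered by \<open>w\<close>. Hence distinct subsets of \<open>R\<close> have distinct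
  sums of rows \<open>f x\<close> modulo 2.\<close>

lemma triangular_count:
  fixes f g :: "'x \<Rightarrow> 's \<Rightarrow> nat" and w :: "'x \<Rightarrow> nat"
  assumes "finite R" "finite T"
    and diag: "\<And>x. x \<in> R \<Longrightarrow> odd (\<Sum>s\<in>T. f x s * g x s)"
    and lower: "\<And>x y. x \<in> R \<Longrightarrow> y \<in> R \<Longrightarrow> x \<noteq> y \<Longrightarrow> w y \<le> w x \<Longrightarrow> even (\<Sum>s\<in>T. f y s * g x s)"
  shows "card R \<le> card T"
proof -
  define \<Phi> where "\<Phi> D = {s\<in>T. odd (\<Sum>x\<in>D. f x s)}" for D
  have "inj_on \<Phi> (Pow R)"
  proof (rule inj_onI, rule ccontr)
    fix D D' assume D: "D \<in> Pow R" "D' \<in> Pow R" "\<Phi> D = \<Phi> D'" and ne: "D \<noteq> D'"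
    define S where "S = (D - D') \<union> (D' - D)"
    have S: "S \<subseteq> R" "S \<noteq> {}" using D ne unfolding S_def by auto
    then have "finite S" using assms(1) finite_subset by blast
    \<comment> \<open>Testing the two equal row sums against the column \<open>g z\<close> of the
      heaviest \<open>z\<close> on which the subsets differ leaves exactly one odd term.\<close>
    define z where "z = arg_max_on w S"
    have z: "z \<in> S" "\<And>y. y \<in> S \<Longrightarrow> w y \<le> w z"
    proof -
      have "\<exists>z\<in>S. \<forall>y\<in>S. w y \<le> w z"
        using S \<open>finite S\<close> Max_in[of "w ` S"] Max_ge[of "w ` S"] by (metis (no_types, lifting) finite_imageI image_iff image_is_empty imageI)
      then have "is_arg_max w (\<lambda>x. x \<in> S) z" unfolding z_def arg_max_on_def arg_max_def
        by (intro someI_ex[where P="is_arg_max w (\<lambda>x. x \<in> S)"]) (auto simp: is_arg_max_linorder)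
      then show "z \<in> S" "\<And>y. y \<in> S \<Longrightarrow> w y \<le> w z" by (auto simp: is_arg_max_linorder)
    qed
    \<comment> \<open>The signed indicator of the symmetric difference: odd on \<open>S\<close> and
      zero elsewhere, so that the difference of the two row sums is a single integer
      combination.\<close>
    define h :: "'x \<Rightarrow> int" where "h x = of_bool (x \<in> D) - of_bool (x \<in> D')" for x
    have ev: "even (\<Sum>x\<in>R. h x * int (f x s))" if "s \<in> T" for s
    proof -
      have *: "(\<Sum>x\<in>R. of_bool (x \<in> K) * int (f x s)) = int (\<Sum>x\<in>K. f x s)" if "K \<subseteq> R" for K
      proof -
        have "(\<Sum>x\<in>R. of_bool (x \<in> K) * int (f x s)) = (\<Sum>x\<in>R. if x \<in> K then int (f x s) else 0)"
          by (intro sum.cong) auto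
        also have "\<dots> = (\<Sum>x\<in>K. int (f x s))" 
          using that assms(1) by (simp add: sum.If_cases Int_absorb1)
        finally show ?thesis by simp
      qed
      have "odd (\<Sum>x\<in>D. f x s) \<longleftrightarrow> odd (\<Sum>x\<in>D'. f x s)" using D(3) that unfolding \<Phi>_def by blast
      then have "even (int (\<Sum>x\<in>D. f x s) - int (\<Sum>x\<in>D'. f x s))" by (simp only: even_diff even_add even_of_nat) simp
      then show ?thesis using *[of D] *[of D'] D by (simp add: h_def left_diff_distrib sum_subtractf)
    qed
    define N where "N x = int (\<Sum>s\<in>T. f x s * g z s)" for x
    have "(\<Sum>x\<in>R. h x * N x) = (\<Sum>s\<in>T. int (g z s) * (\<Sum>x\<in>R. h x * int (f x s)))"
      unfolding N_def by (simp add: sum_distrib_left sum.swap[of _ R T] mult_ac)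
    also have "even \<dots>" using ev by (intro dvd_sum) auto
    finally have 1: "even (\<Sum>x\<in>R. h x * N x)" .
    have "(\<Sum>x\<in>R. h x * N x) = h z * N z + (\<Sum>x\<in>R - {z}. h x * N x)"
      using z S assms(1) by (intro sum.remove) auto
    moreover have "odd (h z * N z)"
    proof -
      have "odd (h z)" using z(1) unfolding h_def S_def by auto
      moreover have "odd (N z)" unfolding N_def using diag[of z] z S by (simp only: even_of_nat) auto
      ultimately show ?thesis by simp
    qed
    moreover have "even (\<Sum>x\<in>R - {z}. h x * N x)"
    proof (intro dvd_sum)
      fix x assume x: "x \<in> R - {z}"
      show "even (h x * N x)"
      proof (cases "x \<in> S")
        case True
        then have "even (N x)" unfolding N_def using lower[of z x] z S x by (simp only: even_of_nat) auto
        then show ?thesis by simp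
      next
        case False
        then have "h x = 0" unfolding h_def S_def by auto
        then show ?thesis by simp
      qed
    qed
    ultimately show False using 1 by simp
  qed
  moreover have "\<Phi> ` Pow R \<subseteq> Pow T" unfolding \<Phi>_def by auto
  ultimately have "card (Pow R) \<le> card (Pow T)" using assms by (intro card_inj_on_le) auto
  then show ?thesis using assms by (simp add: card_Pow)
qed

section \<open>Balanced splittings along a tree decomposition\<close>

definition adj :: "'b set \<Rightarrow> 'b set set \<Rightarrow> ('b \<times> 'b) set" where
  "adj A F = {(x, y). x \<in> A \<and> y \<in> A \<and> {x, y} \<in> F}"

lemma sym_adj: "sym (adj A F)"
  by (auto simp: adj_def sym_def insert_commute)

lemma adj_rtrancl_sym: "(x, y) \<in> (adj A F)\<^sup>* \<Longrightarrow> (y, x) \<in> (adj A F)\<^sup>*"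
  by (meson sym_adj sym_rtrancl symD)

lemma adj_rtrancl_mono: "A \<subseteq> B \<Longrightarrow> (x, y) \<in> (adj A F)\<^sup>* \<Longrightarrow> (x, y) \<in> (adj B F)\<^sup>*"
  by (rule rtrancl_mono[THEN subsetD]) (auto simp: adj_def)

lemma adj_rtrancl_path:
  assumes "(u, v) \<in> (adj A F)\<^sup>*" "v \<in> A"
  shows "\<exists>p. p \<noteq> [] \<and> hd p = u \<and> last p = v \<and> distinct p \<and> set p \<subseteq> A \<and>
    successively (\<lambda>x y. {x, y} \<in> F) p"
  using assms
proof (induction rule: converse_rtrancl_induct)
  case base
  then show ?case by (intro exI[of _ "[v]"]) auto
next
  case (step u u')
  then obtain p where p: "p \<noteq> []" "hd p = u'" "last p = v" "distinct p" "set p \<subseteq> A"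
    "successively (\<lambda>x y. {x, y} \<in> F) p" by blast
  show ?case
  proof (cases "u \<in> set p")
    case True
    then obtain p1 p2 where p12: "p = p1 @ u # p2" by (meson split_list)
    have "successively (\<lambda>x y. {x, y} \<in> F) (u # p2)"
      using p(6) unfolding p12 by (simp only: successively_append_iff)
    moreover have "last (u # p2) = v" "distinct (u # p2)" "set (u # p2) \<subseteq> A" using p(3-5) unfolding p12 by auto
    ultimately show ?thesis by (intro exI[of _ "u # p2"]) simp
  next
    case False
    have "u \<in> A" "{u, u'} \<in> F" using step(1) by (auto simp: adj_def)
    then show ?thesis using p False
      by (intro exI[of _ "u # p"]) (simp add: successively_Cons)
  qed
qed

text \<open>Keep only the part of the walk after its last visit to \<open>x\<close>; it starts at a
  neighbour of \<open>x\<close>. If there is no visit, the whole walk survives the removal of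
  \<open>x\<close>.\<close>

lemma adj_rtrancl_last_exit:
  assumes "(z, y) \<in> (adj A F)\<^sup>*" "y \<in> A" "y \<noteq> x"
  shows "(z \<in> A - {x} \<and> (z, y) \<in> (adj (A - {x}) F)\<^sup>*) \<or>
    (\<exists>y'\<in>A - {x}. {x, y'} \<in> F \<and> (y', y) \<in> (adj (A - {x}) F)\<^sup>*)"
  using assms
proof (induction rule: converse_rtrancl_induct)
  case base then show ?case by auto
next
  case (step z z')
  then show ?case
  proof (cases "z' \<in> A - {x} \<and> (z', y) \<in> (adj (A - {x}) F)\<^sup>*")
    case True
    show ?thesis
    proof (cases "z = x")
      case True
      then show ?thesis using \<open>z' \<in> A - {x} \<and> _\<close> step(1) by (auto simp: adj_def)
    next
      case False
      then have "(z, z') \<in> adj (A - {x}) F" "z \<in> A - {x}" using step(1) True by (auto simp: adj_def)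
      then show ?thesis using True by (meson converse_rtrancl_into_rtrancl)
    qed
  qed auto
qed

text \<open>A path avoiding \<open>x\<close> between two different neighbours of \<open>x\<close>
  would close to a cycle through \<open>x\<close>.\<close>

lemma tree_neighbours_disconnected:
  assumes tree: "is_tree I F" and "{x, y} \<in> F" "{x, y'} \<in> F" "x \<in> I"
    and "y \<in> I - {x}" and conn: "(y', y) \<in> (adj (I - {x}) F)\<^sup>*"
  shows "y = y'"
proof (rule ccontr)
  assume "y \<noteq> y'"
  obtain p where p: "p \<noteq> []" "hd p = y'" "last p = y" "distinct p" "set p \<subseteq> I - {x}"
    "successively (\<lambda>x y. {x, y} \<in> F) p"
    using adj_rtrancl_path[OF conn] assms by blast
  have len: "2 \<le> length p" using p(1-3) \<open>y \<noteq> y'\<close> by (cases p rule: list.exhaust; cases "tl p") auto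
  have "cycle_edges (x # p) \<subseteq> F"
  proof
    fix e assume "e \<in> cycle_edges (x # p)"
    then obtain i where i: "i < Suc (length p)"
      "e = {(x # p) ! i, (x # p) ! (Suc i mod Suc (length p))}"
      unfolding cycle_edges_def by auto
    have s: "successively (\<lambda>x y. {x, y} \<in> F) (x # p)"
      using p assms by (simp add: successively_Cons)
    show "e \<in> F"
    proof (cases "i = length p")
      case True
      then have "e = {last p, x}" using i p(1) by (simp add: last_conv_nth nth_Cons')
      then show ?thesis using p assms by (simp add: insert_commute)
    next
      case False
      then have "Suc i < length (x # p)" using i by simp
      then show ?thesis using s i by (simp add: successively_conv_nth)
    qed
  qed
  then have "is_cycle I F (x # p)" using p len assms unfolding is_cycle_def by auto
  then show False using tree unfolding is_tree_def by blast
qed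

section \<open>Centroids and balanced splits of items placed on a tree\<close>

definition branch :: "'b set \<Rightarrow> 'b set set \<Rightarrow> 'b \<Rightarrow> 'b \<Rightarrow> 'b set" where
  "branch I F x y = {z \<in> I - {x}. (y, z) \<in> (adj (I - {x}) F)\<^sup>*}"

lemma branch_eq: "(y, y') \<in> (adj (I - {x}) F)\<^sup>* \<Longrightarrow> branch I F x y = branch I F x y'"
  unfolding branch_def by (auto intro: rtrancl_trans adj_rtrancl_sym)

text \<open>Otherwise every node has a branch, a component of the tree without that node, holding
  more than half of the items. Choose \<open>x\<close> and such a branch of minimal size, and move
  to the neighbour \<open>y\<close> of \<open>x\<close> inside it. A majority branch at
  \<open>y\<close> must meet the chosen one. If it avoids \<open>x\<close>, it is a strictly smaller
  majority branch; if it contains \<open>x\<close>, there is a way around \<open>y\<close> and thus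
  a cycle.\<close>

lemma tree_centroid:
  assumes tree: "is_tree I F" and A: "finite A" "a ` A \<subseteq> I"
  shows "\<exists>x\<in>I. \<forall>y\<in>I - {x}. 2 * card {z\<in>A. a z \<in> branch I F x y} \<le> card A"
proof (rule ccontr)
  define heavy where "heavy x y \<longleftrightarrow> x \<in> I \<and> y \<in> I - {x} \<and> card A < 2 * card {z\<in>A. a z \<in> branch I F x y}"
    for x y
  assume "\<not> ?thesis"
  then have ex: "\<exists>y. heavy x y" if "x \<in> I" for x using that unfolding heavy_def by force
  have finI: "finite I" and edge: "\<And>e. e \<in> F \<Longrightarrow> e \<subseteq> I"
    and conn: "\<And>u v. u \<in> I \<Longrightarrow> v \<in> I \<Longrightarrow> (u, v) \<in> {(x, y). {x, y} \<in> F}\<^sup>*" and "I \<noteq> {}"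
    using tree unfolding is_tree_def simple_graph_def connected_graph_def by auto
  have "{(x, y). {x, y} \<in> F} = adj I F" using edge by (auto simp: adj_def)
  note conn = conn[unfolded this]
  from ex \<open>I \<noteq> {}\<close> have "\<exists>q. heavy (fst q) (snd q)" by fastforce
  then obtain q where q: "heavy (fst q) (snd q)"
    "\<And>r. heavy (fst r) (snd r) \<Longrightarrow> card (branch I F (fst q) (snd q)) \<le> card (branch I F (fst r) (snd r))"
    using exists_least_iff[of "\<lambda>n. \<exists>q. heavy (fst q) (snd q) \<and> n = card (branch I F (fst q) (snd q))"]
    by (metis not_le)
  define x where "x = fst q"
  have x: "x \<in> I" and "snd q \<in> I - {x}" using q unfolding x_def heavy_def by auto
  obtain y where y: "y \<in> I - {x}" "{x, y} \<in> F" "(y, snd q) \<in> (adj (I - {x}) F)\<^sup>*"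
    using adj_rtrancl_last_exit[OF conn[of x "snd q"], of x] x \<open>snd q \<in> I - {x}\<close> by blast
  define C where "C = branch I F x y"
  have C: "C = branch I F (fst q) (snd q)" using branch_eq[OF y(3)] unfolding C_def x_def by simp
  obtain u where u: "heavy y u" using ex y by blast
  define C' where "C' = branch I F y u"
  have "{z\<in>A. a z \<in> C} \<inter> {z\<in>A. a z \<in> C'} \<noteq> {}"
  proof
    assume "{z\<in>A. a z \<in> C} \<inter> {z\<in>A. a z \<in> C'} = {}"
    then have "card {z\<in>A. a z \<in> C} + card {z\<in>A. a z \<in> C'} = card ({z\<in>A. a z \<in> C} \<union> {z\<in>A. a z \<in> C'})"
      using A by (intro card_Un_disjoint[symmetric]) auto
    also have "\<dots> \<le> card A" using A by (intro card_mono) auto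
    finally show False using u q(1) unfolding heavy_def C C'_def by linarith
  qed
  then obtain w where w: "w \<in> C" "w \<in> C'" by auto
  have uw: "(w, z) \<in> (adj (I - {y}) F)\<^sup>*" if "z \<in> C'" for z
    using w that unfolding C'_def branch_def by (auto intro: rtrancl_trans adj_rtrancl_sym)
  show False
  proof (cases "x \<in> C'")
    case False
    have "(w, z) \<in> (adj (I - {x}) F)\<^sup>* \<and> z \<in> C'" if "(w, z) \<in> (adj (I - {y}) F)\<^sup>*" for z
      using that
    proof (induction rule: rtrancl_induct)
      case base then show ?case using w by simp
    next
      case (step z z')
      have "z' \<in> C'" using step unfolding C'_def branch_def
        by (auto simp: adj_def intro: rtrancl_into_rtrancl)
      then have "(z, z') \<in> adj (I - {x}) F" using step False by (auto simp: adj_def)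
      then show ?case using step \<open>z' \<in> C'\<close> by auto
    qed
    then have "(w, z) \<in> (adj (I - {x}) F)\<^sup>*" "z \<in> I - {x}" if "z \<in> C'" for z
      using uw[OF that] that False unfolding C'_def branch_def by auto
    then have "C' \<subseteq> C" using w unfolding C_def branch_def by (auto intro: rtrancl_trans)
    moreover have "y \<in> C" "y \<notin> C'" using y unfolding C_def C'_def branch_def by auto
    moreover have "finite C" using finI unfolding C_def branch_def by simp
    ultimately have "card C' < card C" by (intro psubset_card_mono) auto
    then show False using q(2)[of "(y, u)"] u unfolding C C'_def by simp
  next
    case True
    have wA: "w \<in> I - {y}" "w \<noteq> x" using w unfolding C_def C'_def branch_def by auto
    \<comment> \<open>The walk from \<open>x\<close> to \<open>w\<close> avoids \<open>y\<close>, so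
      it leaves \<open>x\<close> through another neighbour, which then lies in the same branch at
      \<open>x\<close> as \<open>y\<close>.\<close>
    obtain y' where y': "y' \<in> I - {y} - {x}" "{x, y'} \<in> F" "(y', w) \<in> (adj (I - {y} - {x}) F)\<^sup>*"
      using adj_rtrancl_last_exit[OF adj_rtrancl_sym[OF uw[OF True]] wA] by blast
    have "(y', w) \<in> (adj (I - {x}) F)\<^sup>*" using y'(3) by (rule adj_rtrancl_mono[rotated]) auto
    moreover have "(w, y) \<in> (adj (I - {x}) F)\<^sup>*"
      using w unfolding C_def branch_def by (auto intro: adj_rtrancl_sym)
    ultimately have "y = y'"
      using tree_neighbours_disconnected[OF tree y(2) y'(2) x y(1)] by (meson rtrancl_trans)
    then show False using y' by simp
  qed
qed

text \<open>An element of at least a third of the total weight works alone, since it has at most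
  half. If all elements are lighter than a third, adding them one by one cannot jump over the range
  from one third to two thirds.\<close>

lemma balanced_subset:
  fixes w :: "'a \<Rightarrow> nat"
  assumes "finite Z" and small: "\<And>z. z \<in> Z \<Longrightarrow> 2 * w z \<le> sum w Z"
  shows "\<exists>G\<subseteq>Z. 3 * sum w G \<le> 2 * sum w Z \<and> sum w Z \<le> 3 * sum w G"
proof (cases "\<exists>z\<in>Z. sum w Z \<le> 3 * w z")
  case True
  then obtain z where "z \<in> Z" "sum w Z \<le> 3 * w z" by blast
  then show ?thesis using small[of z] by (intro exI[of _ "{z}"]) auto
next
  case False
  show ?thesis
  proof (rule ccontr)
    assume no: "\<not> ?thesis"
    have "3 * sum w G < sum w Z" if "G \<subseteq> Z" for G
      using finite_subset[OF that assms(1)] that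
    proof (induction G rule: finite_induct)
      case empty
      then show ?case using no by (metis empty_subsetI le_zero_eq mult_is_0 not_le sum.empty zero_le)
    next
      case (insert z G)
      then have "3 * sum w G < sum w Z" "3 * w z < sum w Z" using False by auto
      then have "3 * sum w (insert z G) \<le> 2 * sum w Z" using insert.hyps by simp
      then show ?case using no insert.prems by (meson not_le)
    qed
    from this[of Z] show False by simp
  qed
qed

text \<open>\<open>J\<close> is a union of branches at \<open>x\<close>. Items placed at
  \<open>x\<close> itself may go to either side; otherwise balance would be impossible when most
  items sit at one node.\<close>

definition balanced_split ::
  "'b set \<Rightarrow> 'b set set \<Rightarrow> 'a set \<Rightarrow> ('a \<Rightarrow> 'b) \<Rightarrow> 'b \<Rightarrow> 'b set \<Rightarrow> 'a set \<Rightarrow> bool" where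
  "balanced_split I F A a x J A1 \<longleftrightarrow> x \<in> I \<and> J \<subseteq> I - {x} \<and>
     (\<forall>y\<in>J. \<forall>y'\<in>I - {x}. {y, y'} \<in> F \<longrightarrow> y' \<in> J) \<and>
     A1 \<subseteq> A \<and> (\<forall>z\<in>A. a z \<noteq> x \<longrightarrow> (z \<in> A1 \<longleftrightarrow> a z \<in> J)) \<and>
     3 * card A1 \<le> 2 * card A \<and> 3 * card (A - A1) \<le> 2 * card A"

text \<open>At a centroid, each item placed at \<open>x\<close> forms its own class and the items of
  each branch form one class. No class exceeds half of the items, for singletons because there are
  at least two items, so whole classes can be distributed evenly.\<close>

lemma balanced_split_exists:
  assumes tree: "is_tree I F" and A: "finite A" "a ` A \<subseteq> I" "2 \<le> card A"
  shows "\<exists>x J A1. balanced_split I F A a x J A1"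
proof -
  obtain x where x: "x \<in> I" "\<And>y. y \<in> I - {x} \<Longrightarrow> 2 * card {z\<in>A. a z \<in> branch I F x y} \<le> card A"
    using tree_centroid[OF tree A(1,2)] by blast
  define cls where "cls z = (if a z = x then Inl z else Inr (branch I F x (a z)))" for z
  define w where "w g = card {z\<in>A. cls z = g}" for g
  have sumw: "sum w G = card {z\<in>A. cls z \<in> G}" if "G \<subseteq> cls ` A" for G
  proof -
    have "(\<Sum>g\<in>G. sum (\<lambda>_. 1) {z \<in> {z\<in>A. cls z \<in> G}. cls z = g}) = sum (\<lambda>_. 1::nat) {z\<in>A. cls z \<in> G}"
      using A that by (intro sum.group) (auto intro: finite_subset)
    moreover have "{z \<in> {z\<in>A. cls z \<in> G}. cls z = g} = {z\<in>A. cls z = g}" if "g \<in> G" for g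
      using that by auto
    ultimately show ?thesis unfolding w_def by simp
  qed
  have total: "sum w (cls ` A) = card A" using sumw[of "cls ` A"]
    by (metis (no_types, lifting) Collect_cong Collect_mem_eq imageI order_refl)
  have "2 * w g \<le> sum w (cls ` A)" if g: "g \<in> cls ` A" for g
  proof -
    obtain z0 where z0: "z0 \<in> A" "g = cls z0" using g by auto
    show ?thesis
    proof (cases "a z0 = x")
      case True
      then have "{z\<in>A. cls z = g} \<subseteq> {z0}" using z0 by (auto simp: cls_def split: if_splits)
      then have "w g \<le> 1" unfolding w_def using card_mono[of "{z0}"] by fastforce
      then show ?thesis using A total by simp
    next
      case False
      have "a z \<in> branch I F x (a z0)" if "z \<in> A" "cls z = g" for z
        using that False z0 A by (auto simp: cls_def branch_def split: if_splits)
      then have "w g \<le> card {z\<in>A. a z \<in> branch I F x (a z0)}" unfolding w_def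
        using A by (intro card_mono) auto
      also have "2 * \<dots> \<le> card A" using False z0 A by (intro x(2)) auto
      finally show ?thesis using total by simp
    qed
  qed
  from balanced_subset[OF _ this] obtain G where G: "G \<subseteq> cls ` A"
    "3 * sum w G \<le> 2 * card A" "card A \<le> 3 * sum w G" using A total by fastforce
  define A1 where "A1 = {z\<in>A. cls z \<in> G}"
  define J where "J = {y \<in> I - {x}. Inr (branch I F x y) \<in> G}"
  have A1: "card A1 = sum w G" using sumw[OF G(1)] unfolding A1_def by simp
  have "balanced_split I F A a x J A1"
    unfolding balanced_split_def
  proof (intro conjI ballI impI)
    show "x \<in> I" by fact
    show "J \<subseteq> I - {x}" unfolding J_def by auto
    show "y' \<in> J" if "y \<in> J" "y' \<in> I - {x}" "{y, y'} \<in> F" for y y'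
    proof -
      have "branch I F x y = branch I F x y'"
        using that by (intro branch_eq r_into_rtrancl) (auto simp: adj_def J_def)
      then show ?thesis using that unfolding J_def by simp
    qed
    show "A1 \<subseteq> A" unfolding A1_def by auto
    show "z \<in> A1 \<longleftrightarrow> a z \<in> J" if "z \<in> A" "a z \<noteq> x" for z
      using that A unfolding A1_def J_def cls_def by auto
    show "3 * card A1 \<le> 2 * card A" using A1 G by simp
    have "card (A - A1) = card A - card A1" using A unfolding A1_def by (intro card_Diff_subset) auto
    then show "3 * card (A - A1) \<le> 2 * card A" using A1 G by simp
  qed
  then show ?thesis by blast
qed

section \<open>Recursive splitting of edge sets with small boundary\<close>

definition boundary :: "'a set set \<Rightarrow> 'a set set \<Rightarrow> 'a set" where
  "boundary E P = \<Union>P \<inter> \<Union>(E - P)"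

text \<open>All leaves have the same depth because a level of pieces is served by one prime. Short
  branches are padded by splitting a piece into itself and the empty set.\<close>

primrec hierarchy :: "'a set set \<Rightarrow> nat \<Rightarrow> nat \<Rightarrow> 'a set set \<Rightarrow> bool" where
  "hierarchy E b 0 P \<longleftrightarrow> card (boundary E P) \<le> b \<and> card P \<le> 1"
| "hierarchy E b (Suc k) P \<longleftrightarrow> card (boundary E P) \<le> b \<and>
     (\<exists>P1 P2. P = P1 \<union> P2 \<and> P1 \<inter> P2 = {} \<and> hierarchy E b k P1 \<and> hierarchy E b k P2)"

lemma boundary_empty [simp]: "boundary E {} = {}" "boundary E E = {}"
  by (simp_all add: boundary_def)

lemma hierarchy_trivial:
  "card P \<le> 1 \<Longrightarrow> card (boundary E P) \<le> b \<Longrightarrow> hierarchy E b k P"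
proof (induction k arbitrary: P)
  case (Suc k)
  have "hierarchy E b k {}" by (rule Suc.IH) auto
  then have "P = P \<union> {} \<and> P \<inter> {} = {} \<and> hierarchy E b k P \<and> hierarchy E b k {}"
    using Suc by simp
  then show ?case using Suc.prems by (simp only: hierarchy.simps) blast
qed simp

locale bounded_tree_decomposition =
  fixes V :: "'a set" and E :: "'a set set" and I :: "'b set" and F :: "'b set set"
    and bag :: "'b \<Rightarrow> 'a set" and a :: nat
  assumes graph: "simple_graph V E" and td: "tree_decomposition V E I F bag"
    and bag_card: "x \<in> I \<Longrightarrow> card (bag x) \<le> a" and a_pos: "a \<ge> 1"
begin

lemma tree: "is_tree I F" using td by (simp add: tree_decomposition_def)

lemma finV: "finite V" using graph by (simp add: simple_graph_def)

lemma edge_sub: "e \<in> E \<Longrightarrow> e \<subseteq> V" using graph by (simp add: simple_graph_def)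

lemma finE: "finite E" using finV edge_sub by (meson Pow_iff finite_Pow_iff finite_subset subsetI)

lemma finbag: "x \<in> I \<Longrightarrow> finite (bag x)"
  using td finV by (meson finite_subset tree_decomposition_def)

lemma finbd: "P \<subseteq> E \<Longrightarrow> finite (boundary E P)"
  unfolding boundary_def using edge_sub finV by (auto intro!: finite_subset[of _ V])

text \<open>The nodes whose bags contain \<open>v\<close> are connected and do not include
  \<open>x\<close>, while \<open>J\<close> can be left only through \<open>x\<close>.\<close>

lemma bag_same_side:
  assumes "x \<in> I" "\<forall>y\<in>J. \<forall>y'\<in>I - {x}. {y, y'} \<in> F \<longrightarrow> y' \<in> J"
    and v: "v \<in> V" "v \<notin> bag x" "y \<in> I" "v \<in> bag y" "y' \<in> I" "v \<in> bag y'" and "y \<in> J"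
  shows "y' \<in> J"
proof -
  let ?X = "{x \<in> I. v \<in> bag x}"
  have "(y, y') \<in> {(x, y). {x, y} \<in> {e \<in> F. e \<subseteq> ?X}}\<^sup>*"
    using td v unfolding tree_decomposition_def connected_graph_def Let_def by blast
  then show ?thesis using \<open>y \<in> J\<close>
  proof (induction rule: rtrancl_induct)
    case (step y z)
    then show ?case using assms(2) v(2) by auto
  qed
qed

text \<open>Vertices are placed by the same choice function as edges, through singletons.\<close>

definition home :: "'a set \<Rightarrow> 'b" where "home e = (SOME x. x \<in> I \<and> e \<subseteq> bag x)"

lemma home: "e \<in> E \<Longrightarrow> home e \<in> I" "e \<in> E \<Longrightarrow> e \<subseteq> bag (home e)"
  using td someI_ex[of "\<lambda>x. x \<in> I \<and> e \<subseteq> bag x"] unfolding home_def tree_decomposition_def by blast+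

lemma home_vertex: "v \<in> V \<Longrightarrow> home {v} \<in> I" "v \<in> V \<Longrightarrow> v \<in> bag (home {v})"
proof -
  assume "v \<in> V"
  then have "\<exists>x. x \<in> I \<and> {v} \<subseteq> bag x"
    using td unfolding tree_decomposition_def connected_graph_def Let_def by auto
  from someI_ex[OF this] show "home {v} \<in> I" "v \<in> bag (home {v})" unfolding home_def by auto
qed

text \<open>The items are the edges, placed at their homes. A vertex met by both parts lies in
  \<open>bag x\<close>, since otherwise all bags containing it would be on one side of
  \<open>x\<close>. Hence only the vertices of one bag can be new on a boundary.\<close>

lemma split_edges:
  assumes "P \<subseteq> E" "2 \<le> card P"
  obtains P1 P2 where "P = P1 \<union> P2" "P1 \<inter> P2 = {}" "3 * card P1 \<le> 2 * card P" "3 * card P2 \<le> 2 * card P"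
    "card (boundary E P1) \<le> card (boundary E P) + a" "card (boundary E P2) \<le> card (boundary E P) + a"
proof -
  have "finite P" using assms(1) finE by (rule finite_subset)
  have "home ` P \<subseteq> I" using assms home by auto
  obtain x J P1 where bs: "balanced_split I F P home x J P1"
    using balanced_split_exists[OF tree \<open>finite P\<close> \<open>home ` P \<subseteq> I\<close> assms(2)] by blast
  have s: "x \<in> I" "J \<subseteq> I - {x}"
    "\<forall>y\<in>J. \<forall>y'\<in>I - {x}. {y, y'} \<in> F \<longrightarrow> y' \<in> J"
    "P1 \<subseteq> P" "\<And>e. e \<in> P \<Longrightarrow> home e \<noteq> x \<Longrightarrow> e \<in> P1 \<longleftrightarrow> home e \<in> J"
    "3 * card P1 \<le> 2 * card P" "3 * card (P - P1) \<le> 2 * card P"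
    using bs unfolding balanced_split_def by blast+
  have common: "\<Union>P1 \<inter> \<Union>(P - P1) \<subseteq> bag x"
  proof
    fix v assume "v \<in> \<Union>P1 \<inter> \<Union>(P - P1)"
    then obtain e e' where e: "e \<in> P1" "e' \<in> P - P1" "v \<in> e" "v \<in> e'" by blast
    then have E: "e \<in> E" "e' \<in> E" using assms(1) s(4) by auto
    have h: "home e \<in> I" "home e' \<in> I" "v \<in> bag (home e)" "v \<in> bag (home e')" "v \<in> V"
      using home(1)[OF E(1)] home(1)[OF E(2)] home(2)[OF E(1)] home(2)[OF E(2)] edge_sub[OF E(1)] e(3,4)
      by auto
    show "v \<in> bag x"
    proof (rule ccontr)
      assume nv: "v \<notin> bag x"
      then have "home e \<noteq> x" "home e' \<noteq> x" using h by auto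
      then have "home e \<in> J" "home e' \<notin> J" using s(5)[of e] s(5)[of e'] e s(4) by auto
      then show False using bag_same_side[OF s(1,3) h(5) nv h(1,3,2,4)] by simp
    qed
  qed
  have *: "card (boundary E Q) \<le> card (boundary E P) + a" if "boundary E Q \<subseteq> boundary E P \<union> bag x" for Q
  proof -
    have "card (boundary E Q) \<le> card (boundary E P \<union> bag x)"
      using that finbd assms finbag s(1) by (intro card_mono) auto
    also have "\<dots> \<le> card (boundary E P) + card (bag x)" by (rule card_Un_le)
    finally show ?thesis using bag_card[OF s(1)] by simp
  qed
  show ?thesis
  proof
    show "P = P1 \<union> (P - P1)" "P1 \<inter> (P - P1) = {}" using s by auto
    show "card (boundary E P1) \<le> card (boundary E P) + a"
      using common s(4) assms by (intro *) (simp add: boundary_def, blast)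
    show "card (boundary E (P - P1)) \<le> card (boundary E P) + a"
      using common s(4) assms by (intro *) (simp add: boundary_def, blast)
  qed (use s in auto)
qed

text \<open>Here the items are the boundary vertices, and the edges follow the side of their home.
  Apart from the bag of \<open>x\<close>, each part inherits only the boundary vertices of its own
  side.\<close>

lemma split_boundary:
  assumes "P \<subseteq> E"
  obtains P1 P2 where "P = P1 \<union> P2" "P1 \<inter> P2 = {}"
    "3 * card (boundary E P1) \<le> 2 * card (boundary E P) + 3 * a"
    "3 * card (boundary E P2) \<le> 2 * card (boundary E P) + 3 * a"
proof (cases "2 \<le> card (boundary E P)")
  case False
  then show ?thesis using that[of P "{}"] a_pos by auto
next
  case True
  let ?B = "boundary E P"
  have BV: "?B \<subseteq> V" unfolding boundary_def using edge_sub assms by auto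
  then have hB: "(\<lambda>v. home {v}) ` ?B \<subseteq> I" using home_vertex by auto
  obtain x J B1 where bs: "balanced_split I F ?B (\<lambda>v. home {v}) x J B1"
    using balanced_split_exists[OF tree finbd[OF assms] hB True] by blast
  have s: "x \<in> I" "J \<subseteq> I - {x}"
    "\<forall>y\<in>J. \<forall>y'\<in>I - {x}. {y, y'} \<in> F \<longrightarrow> y' \<in> J"
    "B1 \<subseteq> ?B" "\<And>v. v \<in> ?B \<Longrightarrow> home {v} \<noteq> x \<Longrightarrow> v \<in> B1 \<longleftrightarrow> home {v} \<in> J"
    "3 * card B1 \<le> 2 * card ?B" "3 * card (?B - B1) \<le> 2 * card ?B"
    using bs unfolding balanced_split_def by blast+
  define P1 where "P1 = {e \<in> P. home e \<in> J}"
  \<comment> \<open>Outside the bag of \<open>x\<close>, a vertex and all edges of \<open>P\<close>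
    at it have their homes on the same side.\<close>
  have side: "home {v} \<in> J \<longleftrightarrow> home e \<in> J" if "v \<in> e" "e \<in> P" "v \<notin> bag x" for v e
  proof -
    have "v \<in> V" "e \<in> E" using that assms edge_sub by auto
    note h = home_vertex[OF \<open>v \<in> V\<close>] home(1)[OF \<open>e \<in> E\<close>] subsetD[OF home(2)[OF \<open>e \<in> E\<close>] that(1)]
    show ?thesis
      using bag_same_side[OF s(1,3) \<open>v \<in> V\<close> that(3) h] bag_same_side[OF s(1,3) \<open>v \<in> V\<close> that(3) h(3,4,1,2)] by blast
  qed
  have Bside: "v \<in> B1 \<longleftrightarrow> home {v} \<in> J" if "v \<in> ?B" "v \<notin> bag x" for v
    using s(5)[OF that(1)] home_vertex(2)[of v] that BV by auto
  have common: "\<Union>P1 \<inter> \<Union>(P - P1) \<subseteq> bag x"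
    using side unfolding P1_def by blast
  have sub: "boundary E P1 \<subseteq> B1 \<union> bag x" "boundary E (P - P1) \<subseteq> (?B - B1) \<union> bag x"
  proof -
    show "boundary E P1 \<subseteq> B1 \<union> bag x"
    proof
      fix v assume v: "v \<in> boundary E P1"
      show "v \<in> B1 \<union> bag x"
      proof (cases "v \<in> bag x")
        case False
        then have "v \<in> ?B" using v common assms unfolding boundary_def P1_def by blast
        moreover have "home {v} \<in> J" using v side False unfolding boundary_def P1_def by blast
        ultimately show ?thesis using Bside False by blast
      qed simp
    qed
    show "boundary E (P - P1) \<subseteq> (?B - B1) \<union> bag x"
    proof
      fix v assume v: "v \<in> boundary E (P - P1)"
      show "v \<in> (?B - B1) \<union> bag x"
      proof (cases "v \<in> bag x")
        case False
        then have "v \<in> ?B" using v common assms unfolding boundary_def P1_def by blast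
        moreover have "home {v} \<notin> J" using v side False unfolding boundary_def P1_def by blast
        ultimately show ?thesis using Bside False by blast
      qed simp
    qed
  qed
  have *: "card S \<le> card T + a" if "S \<subseteq> T \<union> bag x" "T \<subseteq> ?B" for S T
  proof -
    have "card S \<le> card (T \<union> bag x)"
      using that finite_subset[OF that(2) finbd[OF assms]] finbag s(1) by (intro card_mono) auto
    also have "\<dots> \<le> card T + card (bag x)" by (rule card_Un_le)
    finally show ?thesis using bag_card[OF s(1)] by simp
  qed
  show ?thesis
  proof
    show "P = P1 \<union> (P - P1)" "P1 \<inter> (P - P1) = {}" unfolding P1_def by auto
    show "3 * card (boundary E P1) \<le> 2 * card ?B + 3 * a"
      using *[OF sub(1) s(4)] s(6) by simp
    show "3 * card (boundary E (P - P1)) \<le> 2 * card ?B + 3 * a"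
      using *[OF sub(2)] s(7) by simp
  qed
qed

text \<open>Each round splits the edges evenly, which may let a boundary grow from \<open>5a\<close> to \<open>6a\<close>,
  and then splits the boundary evenly, which brings it back to \<open>2/3 * 6a + a = 5a\<close>.\<close>

lemma hierarchy_exists:
  assumes "P \<subseteq> E" "card (boundary E P) \<le> 5 * a" "2 ^ j * card P \<le> 3 ^ j"
  shows "hierarchy E (6 * a) (2 * j) P"
  using assms
proof (induction j arbitrary: P)
  case 0
  then show ?case by simp
next
  case (Suc j)
  show ?case
  proof (cases "2 \<le> card P")
    case False
    then show ?thesis using Suc.prems by (intro hierarchy_trivial) auto
  next
    case True
    have half: "hierarchy E (6 * a) (Suc (2 * j)) Q"
      if Q: "Q \<subseteq> E" "3 * card Q \<le> 2 * card P" "card (boundary E Q) \<le> card (boundary E P) + a" for Q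
    proof -
      obtain Q1 Q2 where q: "Q = Q1 \<union> Q2" "Q1 \<inter> Q2 = {}"
        "3 * card (boundary E Q1) \<le> 2 * card (boundary E Q) + 3 * a"
        "3 * card (boundary E Q2) \<le> 2 * card (boundary E Q) + 3 * a"
        by (rule split_boundary[OF Q(1)])
      have "hierarchy E (6 * a) (2 * j) R" if R: "R \<subseteq> Q" "3 * card (boundary E R) \<le> 2 * card (boundary E Q) + 3 * a" for R
      proof (rule Suc.IH)
        show "R \<subseteq> E" using R Q by auto
        show "card (boundary E R) \<le> 5 * a" using R Q Suc.prems by simp
        \<comment> \<open>A boundary split need not shrink the piece; the factor 2/3 per round comes
          from the edge split before it.\<close>
        have "card R \<le> card Q" using R Q finE finite_subset by (intro card_mono) auto
        then have "3 * card R \<le> 2 * card P" using Q by simp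
        then have "2 ^ j * (3 * card R) \<le> 2 ^ j * (2 * card P)" by (rule mult_le_mono2)
        also have "\<dots> = 2 ^ Suc j * card P" by simp
        also have "\<dots> \<le> 3 * 3 ^ j" using Suc.prems(3) by simp
        finally have "3 * (2 ^ j * card R) \<le> 3 * 3 ^ j" by (simp only: mult.left_commute[of 3])
        then show "2 ^ j * card R \<le> 3 ^ j" by simp
      qed
      from this[of Q1] this[of Q2] have "hierarchy E (6 * a) (2 * j) Q1" "hierarchy E (6 * a) (2 * j) Q2"
        using q by auto
      moreover have "card (boundary E Q) \<le> 6 * a" using Q Suc.prems by simp
      ultimately show ?thesis using q(1,2) unfolding hierarchy.simps(2)[of _ _ "2 * j"] by blast
    qed
    obtain P1 P2 where p: "P = P1 \<union> P2" "P1 \<inter> P2 = {}" "3 * card P1 \<le> 2 * card P" "3 * card P2 \<le> 2 * card P"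
      "card (boundary E P1) \<le> card (boundary E P) + a" "card (boundary E P2) \<le> card (boundary E P) + a"
      by (rule split_edges[OF Suc.prems(1) True])
    have "hierarchy E (6 * a) (Suc (2 * j)) P1" "hierarchy E (6 * a) (Suc (2 * j)) P2"
      using half[of P1] half[of P2] p Suc.prems by auto
    moreover have "card (boundary E P) \<le> 6 * a" using Suc.prems by simp
    ultimately have "hierarchy E (6 * a) (Suc (Suc (2 * j))) P" 
      unfolding hierarchy.simps(2)[of _ _ "Suc (2 * j)"] using p(1,2) by blast
    then show ?thesis by simp
  qed
qed

end

text \<open>Levels are numbered from the leaves, so that level \<open>i\<close> is the one to be
  isolated after \<open>i\<close> primes have been drawn. The cardinality bound is for the union
  bound over a level.\<close>

definition splitting_levels :: "'a set set \<Rightarrow> nat \<Rightarrow> nat \<Rightarrow> 'a set set \<Rightarrow> (nat \<Rightarrow> 'a set set set) \<Rightarrow> bool" where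
  "splitting_levels E b k P \<P> \<longleftrightarrow> \<P> k = {P} \<and> (\<forall>i\<le>k. finite (\<P> i) \<and> card (\<P> i) \<le> 2 ^ (k - i)) \<and>
    (\<forall>i\<le>k. \<forall>Q\<in>\<P> i. Q \<subseteq> P \<and> card (boundary E Q) \<le> b) \<and> (\<forall>Q\<in>\<P> 0. card Q \<le> 1) \<and>
    (\<forall>i<k. \<forall>Q\<in>\<P> (Suc i). \<exists>Q1\<in>\<P> i. \<exists>Q2\<in>\<P> i. Q = Q1 \<union> Q2 \<and> Q1 \<inter> Q2 = {})"

lemma splitting_levels_exists:
  assumes "hierarchy E b k P"
  shows "\<exists>\<P>. splitting_levels E b k P \<P>"
  using assms
proof (induction k arbitrary: P)
  case 0
  then show ?case by (intro exI[of _ "\<lambda>_. {P}"]) (simp add: splitting_levels_def)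
next
  case (Suc k)
  then obtain P1 P2 where p: "P = P1 \<union> P2" "P1 \<inter> P2 = {}" "hierarchy E b k P1" "hierarchy E b k P2"
    and b: "card (boundary E P) \<le> b" by auto
  obtain \<P>1 where l1: "splitting_levels E b k P1 \<P>1"
    using Suc.IH[OF p(3)] by blast
  then have 1: "\<P>1 k = {P1}"
    "\<forall>i\<le>k. finite (\<P>1 i) \<and> card (\<P>1 i) \<le> 2 ^ (k - i)"
    "\<forall>i\<le>k. \<forall>Q\<in>\<P>1 i. Q \<subseteq> P1 \<and> card (boundary E Q) \<le> b" "\<forall>Q\<in>\<P>1 0. card Q \<le> 1"
    "\<forall>i<k. \<forall>Q\<in>\<P>1 (Suc i). \<exists>Q1\<in>\<P>1 i. \<exists>Q2\<in>\<P>1 i. Q = Q1 \<union> Q2 \<and> Q1 \<inter> Q2 = {}"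
    unfolding splitting_levels_def by simp_all
  obtain \<P>2 where l2: "splitting_levels E b k P2 \<P>2"
    using Suc.IH[OF p(4)] by blast
  then have 2: "\<P>2 k = {P2}"
    "\<forall>i\<le>k. finite (\<P>2 i) \<and> card (\<P>2 i) \<le> 2 ^ (k - i)"
    "\<forall>i\<le>k. \<forall>Q\<in>\<P>2 i. Q \<subseteq> P2 \<and> card (boundary E Q) \<le> b" "\<forall>Q\<in>\<P>2 0. card Q \<le> 1"
    "\<forall>i<k. \<forall>Q\<in>\<P>2 (Suc i). \<exists>Q1\<in>\<P>2 i. \<exists>Q2\<in>\<P>2 i. Q = Q1 \<union> Q2 \<and> Q1 \<inter> Q2 = {}"
    unfolding splitting_levels_def by simp_all
  define \<P> where "\<P> i = (if i = Suc k then {P} else \<P>1 i \<union> \<P>2 i)" for i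
  show ?case
  unfolding splitting_levels_def
  proof (intro exI[of _ \<P>] conjI allI impI ballI)
    show "\<P> (Suc k) = {P}" by (simp add: \<P>_def)
  next
    fix i assume i: "i \<le> Suc k"
    show "finite (\<P> i)" using i 1(2) 2(2) by (auto simp: \<P>_def le_Suc_eq)
    show "card (\<P> i) \<le> 2 ^ (Suc k - i)"
    proof (cases "i = Suc k")
      case False
      then have ik: "i \<le> k" using i by simp
      have "card (\<P> i) \<le> card (\<P>1 i) + card (\<P>2 i)" using False by (simp add: \<P>_def card_Un_le)
      also have "\<dots> \<le> 2 ^ (k - i) + 2 ^ (k - i)" using 1(2) 2(2) ik by (intro add_mono) auto
      also have "\<dots> = 2 ^ (Suc k - i)" using ik by (simp add: Suc_diff_le)
      finally show ?thesis .
    qed (simp add: \<P>_def)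
  next
    fix i Q assume i: "i \<le> Suc k" "Q \<in> \<P> i"
    have "Q \<subseteq> P \<and> card (boundary E Q) \<le> b"
    proof (cases "i = Suc k")
      case False
      then have "i \<le> k" "Q \<in> \<P>1 i \<or> Q \<in> \<P>2 i" using i by (auto simp: \<P>_def)
      then show ?thesis using 1(3) 2(3) p(1) by blast
    qed (use i b in \<open>simp add: \<P>_def\<close>)
    then show "Q \<subseteq> P" "card (boundary E Q) \<le> b" by simp_all
  next
    fix Q assume "Q \<in> \<P> 0"
    then show "card Q \<le> 1" using 1(4) 2(4) by (auto simp: \<P>_def)
  next
    fix i Q assume i: "i < Suc k" "Q \<in> \<P> (Suc i)"
    show "\<exists>Q1\<in>\<P> i. \<exists>Q2\<in>\<P> i. Q = Q1 \<union> Q2 \<and> Q1 \<inter> Q2 = {}"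
    proof (cases "i = k")
      case True
      then have "Q = P" "P1 \<in> \<P> i" "P2 \<in> \<P> i" using i 1(1) 2(1) by (auto simp: \<P>_def)
      then show ?thesis using p by blast
    next
      case False
      then have "i < k" "Q \<in> \<P>1 (Suc i) \<or> Q \<in> \<P>2 (Suc i)" using i by (auto simp: \<P>_def)
      moreover have "\<P>1 i \<subseteq> \<P> i" "\<P>2 i \<subseteq> \<P> i" using i by (auto simp: \<P>_def)
      ultimately show ?thesis using 1(5)[rule_format, of i Q] 2(5)[rule_format, of i Q] by (meson subsetD)
    qed
  qed
qed

lemma treewidth_tree_decomposition:
  assumes "simple_graph V E" "V \<noteq> {}" "treewidth V E \<le> t"
  obtains I :: "nat set" and F bag where "tree_decomposition V E I F bag"
    "\<And>x. x \<in> I \<Longrightarrow> card (bag x) \<le> Suc t"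
proof -
  \<comment> \<open>A single node carries no cycle, so one bag containing all vertices is a tree
    decomposition and the minimum in \<open>treewidth\<close> is attained.\<close>
  have "\<not> (set p \<subseteq> {0::nat} \<and> distinct p \<and> 3 \<le> length p)" for p
    using card_mono[of "{0::nat}" "set p"] by (auto simp: distinct_card)
  then have "tree_decomposition V E {0::nat} {} (\<lambda>_. V)"
    using assms unfolding tree_decomposition_def is_tree_def simple_graph_def connected_graph_def
    by (auto simp: is_cycle_def Let_def)
  then have "\<exists>k. \<exists>(I :: nat set) F bag. tree_decomposition V E I F bag \<and> decomposition_width I bag = k"
    by blast
  from LeastI_ex[OF this] obtain I :: "nat set" and F bag where
    d: "tree_decomposition V E I F bag" "decomposition_width I bag = treewidth V E"
    unfolding treewidth_def by blast
  have "finite I" using d(1) unfolding tree_decomposition_def is_tree_def simple_graph_def by blast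
  then have "card (bag x) \<le> Suc t" if "x \<in> I" for x
  proof -
    have "card (bag x) \<le> Max ((\<lambda>x. card (bag x)) ` I)" using \<open>finite I\<close> that by simp
    then show ?thesis using d(2) assms(3) unfolding decomposition_width_def by linarith
  qed
  then show ?thesis using that d(1) by blast
qed

section \<open>Hamiltonian cycles and two-colourings\<close>

definition deg :: "'a set set \<Rightarrow> 'a \<Rightarrow> nat" where
  "deg Z v = card {e \<in> Z. v \<in> e}"

lemma deg_eq_card_neighbours:
  assumes "\<And>e. e \<in> Z \<Longrightarrow> card e = 2"
  shows "deg Z v = card {u. {v, u} \<in> Z}"
proof -
  have "{e \<in> Z. v \<in> e} = (\<lambda>u. {v, u}) ` {u. {v, u} \<in> Z}"
  proof (intro equalityI subsetI)
    fix e assume e: "e \<in> {e \<in> Z. v \<in> e}"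
    then obtain x y where "e = {x, y}" using assms card_2_iff by (metis (no_types) mem_Collect_eq)
    then show "e \<in> (\<lambda>u. {v, u}) ` {u. {v, u} \<in> Z}" using e by (auto simp: insert_commute)
  qed auto
  moreover have "inj_on (\<lambda>u. {v, u}) A" for A by (auto simp: inj_on_def doubleton_eq_iff)
  ultimately show ?thesis unfolding deg_def by (simp add: card_image)
qed

lemma mem_cycle_edges_iff:
  "e \<in> cycle_edges p \<longleftrightarrow> (\<exists>i<length p. e = {p ! i, p ! (Suc i mod length p)})"
  by (auto simp: cycle_edges_def)

lemma cycle_neighbours:
  assumes "distinct p" "3 \<le> length p" "i < length p"
  shows "\<exists>j k. j < length p \<and> k < length p \<and> j \<noteq> k \<and> {p ! i, p ! j} \<in> cycle_edges p \<and>
    {p ! i, p ! k} \<in> cycle_edges p \<and> {u. {p ! i, u} \<in> cycle_edges p} = {p ! j, p ! k}"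
proof -
  define n where "n = length p"
  define j k where "j = Suc i mod n" and "k = (if i = 0 then n - 1 else i - 1)"
  have jk: "j < n" "k < n" "Suc k mod n = i" "j \<noteq> k"
    using assms unfolding j_def k_def n_def by (auto simp: mod_Suc)
  have e: "{p ! l, p ! (Suc l mod n)} \<in> cycle_edges p" if "l < n" for l
    using that unfolding mem_cycle_edges_iff n_def by metis
  have "{p ! i, p ! j} \<in> cycle_edges p" "{p ! i, p ! k} \<in> cycle_edges p"
    using e[of i] e[of k] jk assms unfolding j_def n_def by (auto simp: insert_commute)
  moreover have "u \<in> {p ! j, p ! k}" if u: "{p ! i, u} \<in> cycle_edges p" for u
  proof -
    obtain l where l: "l < n" "{p ! i, u} = {p ! l, p ! (Suc l mod n)}"
      using u unfolding mem_cycle_edges_iff n_def by metis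
    from l(2) consider "p ! i = p ! l" "u = p ! (Suc l mod n)" | "p ! i = p ! (Suc l mod n)" "u = p ! l"
      unfolding doubleton_eq_iff by argo
    then show ?thesis
    proof cases
      case 1
      then have "i = l" using assms l by (simp add: nth_eq_iff_index_eq n_def)
      then show ?thesis using 1 j_def by simp
    next
      case 2
      have "Suc l mod n < n" using l by simp
      then have "i = Suc l mod n" using assms l 2 by (simp add: nth_eq_iff_index_eq n_def)
      then have "l = k" using l unfolding k_def by (auto simp: mod_Suc split: if_splits)
      then show ?thesis using 2 by simp
    qed
  qed
  ultimately show ?thesis using jk unfolding n_def by blast
qed

text \<open>This form suits the merging of pieces better than cyclic lists: degrees add up over
  disjoint edge sets, and connectedness can be detected by a parity.\<close>

definition hamiltonian :: "'a set \<Rightarrow> 'a set set \<Rightarrow> bool" where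
  "hamiltonian V Z \<longleftrightarrow> (\<forall>v\<in>V. deg Z v = 2) \<and> connected_graph V Z"

lemma HC_imp_hamiltonian:
  assumes G: "simple_graph V E" and "Z \<in> HC V E"
  shows "Z \<subseteq> E \<and> hamiltonian V Z"
proof -
  obtain p where p: "Z = cycle_edges p" "3 \<le> length p" "distinct p" "set p = V" "Z \<subseteq> E"
    using assms unfolding HC_def is_cycle_def by blast
  have c2: "card e = 2" if "e \<in> Z" for e using that p G unfolding simple_graph_def by blast
  have "deg Z v = 2" if v: "v \<in> V" for v
  proof -
    obtain i where i: "i < length p" "v = p ! i" using v[folded p(4)] by (auto simp: in_set_conv_nth)
    obtain j k where jk: "j < length p" "k < length p" "j \<noteq> k" "{u. {v, u} \<in> Z} = {p ! j, p ! k}"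
      using cycle_neighbours[OF p(3,2) i(1)] i p(1) by blast
    then have "p ! j \<noteq> p ! k" using p by (simp add: nth_eq_iff_index_eq)
    then show ?thesis using deg_eq_card_neighbours[where Z = Z and v = v, OF c2] jk by simp
  qed
  moreover have "connected_graph V Z"
  proof -
    let ?R = "{(x, y). {x, y} \<in> Z}"
    have "(p ! 0, p ! i) \<in> ?R\<^sup>*" if "i < length p" for i
      using that
    proof (induction i)
      case (Suc i)
      have "{p ! i, p ! (Suc i mod length p)} \<in> Z" using Suc.prems unfolding p(1) mem_cycle_edges_iff by (intro exI[of _ i]) simp
      then have "(p ! i, p ! Suc i) \<in> ?R" using Suc.prems by simp
      then show ?case using Suc by (meson Suc_lessD rtrancl.rtrancl_into_rtrancl)
    qed simp
    then have r: "(p ! 0, v) \<in> ?R\<^sup>*" if "v \<in> V" for v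
      using that[folded p(4)] by (auto simp: in_set_conv_nth)
    have "sym (?R\<^sup>*)" by (intro sym_rtrancl) (auto simp: sym_def insert_commute)
    then have "(u, v) \<in> ?R\<^sup>*" if "u \<in> V" "v \<in> V" for u v
      using r that by (meson rtrancl_trans symD)
    moreover have "V \<noteq> {}" using p by auto
    ultimately show ?thesis unfolding connected_graph_def by blast
  qed
  ultimately show ?thesis using p unfolding hamiltonian_def by blast
qed

text \<open>On a longest path, both neighbours of the first vertex \<open>x\<close> lie on the path.
  The neighbour other than \<open>p ! 1\<close> must be the last vertex, so the path closes to a
  cycle. Its vertices have no further edges, and by connectedness it is everything.\<close>

lemma hamiltonian_imp_HC:
  assumes G: "simple_graph V E" and Z: "Z \<subseteq> E" "hamiltonian V Z"
  shows "Z \<in> HC V E"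
proof -
  let ?R = "{(x, y). {x, y} \<in> Z}"
  have finV: "finite V" and c2: "\<And>e. e \<in> Z \<Longrightarrow> card e = 2" and eV: "\<And>e. e \<in> Z \<Longrightarrow> e \<subseteq> V"
    using G Z unfolding simple_graph_def by auto
  have nb: "card {u. {v, u} \<in> Z} = 2" if "v \<in> V" for v
    using that Z deg_eq_card_neighbours[where Z = Z and v = v, OF c2] unfolding hamiltonian_def by simp
  have finnb: "finite {u. {v, u} \<in> Z}" for v
    by (rule finite_subset[OF _ finV]) (use eV in blast)
  have noloop: "{v, v} \<notin> Z" for v using c2[of "{v, v}"] by auto
  define paths where "paths = {p. p \<noteq> [] \<and> distinct p \<and> set p \<subseteq> V \<and> successively (\<lambda>x y. {x, y} \<in> Z) p}"
  obtain v where "v \<in> V" using Z unfolding hamiltonian_def connected_graph_def by blast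
  then have v: "[v] \<in> paths" unfolding paths_def by simp
  have len_le: "length q \<le> card V" if "q \<in> paths" for q
    using that finV card_mono[of V "set q"] unfolding paths_def by (auto simp: distinct_card)
  have "\<exists>p. p \<in> paths \<and> (\<forall>q. q \<in> paths \<longrightarrow> length q \<le> length p)"
    by (rule ex_has_greatest_nat[of _ "[v]" _ "Suc (card V)"]) (use v len_le in \<open>auto simp: less_Suc_eq_le\<close>)
  then obtain p where p: "p \<in> paths" and pmax: "\<And>q. q \<in> paths \<Longrightarrow> length q \<le> length p"
    by blast
  obtain x q where pq: "p = x # q" using p unfolding paths_def by (cases p) auto
  have pp: "distinct p" "set p \<subseteq> V" "successively (\<lambda>x y. {x, y} \<in> Z) p" using p unfolding paths_def by auto
  have step: "{p ! i, p ! Suc i} \<in> Z" if "Suc i < length p" for i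
    using pp(3) that by (simp add: successively_conv_nth)
  have xV: "x \<in> V" using pp pq by simp
  have nbx: "u \<in> set p" if "{x, u} \<in> Z" for u
  proof (rule ccontr)
    assume "u \<notin> set p"
    then have "u # p \<in> paths" using pp that eV[OF that] pq unfolding paths_def
      by (auto simp: successively_Cons insert_commute)
    then show False using pmax by fastforce
  qed
  obtain y1 y2 where y: "{u. {x, u} \<in> Z} = {y1, y2}" "y1 \<noteq> y2" using nb[OF xV] card_2_iff by metis
  have yq: "y1 \<in> set q" "y2 \<in> set q" using nbx noloop y pq by fastforce+
  then have "card {y1, y2} \<le> card (set q)" by (intro card_mono) auto
  then have len: "3 \<le> length p" using y pp pq by (auto simp: distinct_card)
  have p0: "p ! 0 = x" using pq by simp
  have "{x, p ! 1} \<in> Z" using step[of 0] len p0 by simp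
  then have "p ! 1 \<in> {y1, y2}" using y by blast
  then obtain y3 where y3: "y3 \<in> {y1, y2}" "y3 \<noteq> p ! 1" using y by blast
  then have "{x, y3} \<in> Z" "y3 \<in> set p" using y nbx by auto
  then obtain j where j: "j < length p" "y3 = p ! j" by (metis in_set_conv_nth)
  have j2: "2 \<le> j" using y3 j noloop[of x] \<open>{x, y3} \<in> Z\<close> p0
    by (metis One_nat_def Suc_leI less_2_cases not_le)
  \<comment> \<open>An inner vertex \<open>p ! j\<close> adjacent to \<open>x\<close> would have
    three neighbours: \<open>x\<close> and its two neighbours on the path.\<close>
  have "Suc j = length p"
  proof (rule ccontr)
    assume "Suc j \<noteq> length p"
    then have j': "Suc j < length p" using j by simp
    have "{x, p ! (j - 1), p ! Suc j} \<subseteq> {u. {p ! j, u} \<in> Z}"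
      using step[of j] step[of "j - 1"] j' j2 \<open>{x, y3} \<in> Z\<close> j by (auto simp: insert_commute)
    then have "card {x, p ! (j - 1), p ! Suc j} \<le> card {u. {p ! j, u} \<in> Z}"
      by (rule card_mono[OF finnb])
    also have "\<dots> = 2" using nb pp(2) j(1) nth_mem by blast
    finally have "card {x, p ! (j - 1), p ! Suc j} \<le> 2" .
    moreover have "p ! 0 \<noteq> p ! (j - 1)" "p ! 0 \<noteq> p ! Suc j" "p ! (j - 1) \<noteq> p ! Suc j"
      using pp(1) j' j2 by (subst nth_eq_iff_index_eq; auto)+
    ultimately show False using p0 by simp
  qed
  have cyc: "cycle_edges p \<subseteq> Z"
  proof
    fix e assume "e \<in> cycle_edges p"
    then obtain i where i: "i < length p" "e = {p ! i, p ! (Suc i mod length p)}"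
      unfolding mem_cycle_edges_iff by metis
    show "e \<in> Z"
    proof (cases "Suc i < length p")
      case True then show ?thesis using i step by simp
    next
      case False
      then have "Suc i = length p" using i by simp
      then have "i = j" using \<open>Suc j = length p\<close> by simp
      then have "e = {p ! j, x}" using i \<open>Suc i = length p\<close> p0 by simp
      then show ?thesis using \<open>{x, y3} \<in> Z\<close> j by (simp add: insert_commute)
    qed
  qed
  \<comment> \<open>The two neighbours along the cycle already use up the degree 2, so no edge of
    \<open>Z\<close> leaves the cycle.\<close>
  have nbp: "u \<in> set p \<and> {p ! i, u} \<in> cycle_edges p" if i: "i < length p" and u: "{p ! i, u} \<in> Z" for i u
  proof -
    obtain j k where jk: "j < length p" "k < length p" "j \<noteq> k" "{p ! i, p ! j} \<in> cycle_edges p"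
      "{p ! i, p ! k} \<in> cycle_edges p"
      using cycle_neighbours[OF pp(1) len i] by blast
    have "card {p ! j, p ! k} = 2" using jk pp by (simp add: nth_eq_iff_index_eq)
    moreover have "{p ! j, p ! k} \<subseteq> {u. {p ! i, u} \<in> Z}" using jk cyc by auto
    moreover have "card {u. {p ! i, u} \<in> Z} = 2" using nb pp i nth_mem by blast
    ultimately have "{p ! j, p ! k} = {u. {p ! i, u} \<in> Z}" using card_subset_eq[OF finnb] by metis
    then have "u = p ! j \<or> u = p ! k" using u by blast
    then show ?thesis using jk by auto
  qed
  have "set p = V"
  proof
    show "V \<subseteq> set p"
    proof
      fix u assume "u \<in> V"
      then have "(x, u) \<in> ?R\<^sup>*" using Z xV unfolding hamiltonian_def connected_graph_def by blast
      then show "u \<in> set p"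
      proof (induction rule: rtrancl_induct)
        case base show ?case using pq by simp
      next
        case (step y z) then show ?case using nbp by (metis (mono_tags) CollectD case_prodD in_set_conv_nth)
      qed
    qed
  qed (use pp in simp)
  moreover have "Z \<subseteq> cycle_edges p"
  proof
    fix e assume e: "e \<in> Z"
    then obtain a b where ab: "e = {a, b}" using c2 card_2_iff by metis
    then have "a \<in> set p" using eV[OF e] \<open>set p = V\<close> by auto
    then show "e \<in> cycle_edges p" using nbp e ab by (metis in_set_conv_nth)
  qed
  ultimately show ?thesis using cyc pp len Z unfolding HC_def is_cycle_def by blast
qed

lemma HC_iff_hamiltonian: "simple_graph V E \<Longrightarrow> Z \<in> HC V E \<longleftrightarrow> Z \<subseteq> E \<and> hamiltonian V Z"
  using HC_imp_hamiltonian hamiltonian_imp_HC by metis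

text \<open>That all Hamiltonian cycles have equally many edges starts the induction: it isolates
  pieces with at most one edge under any weights.\<close>

lemma card_HC:
  assumes "Z \<in> HC V E" shows "card Z = card V"
proof -
  obtain p where p: "Z = cycle_edges p" "3 \<le> length p" "distinct p" "set p = V"
    using assms unfolding HC_def is_cycle_def by blast
  let ?n = "length p"
  have "inj_on (\<lambda>i. {p ! i, p ! (Suc i mod ?n)}) {..<?n}"
  proof (rule inj_onI)
    fix i j assume ij: "i \<in> {..<?n}" "j \<in> {..<?n}" "{p ! i, p ! (Suc i mod ?n)} = {p ! j, p ! (Suc j mod ?n)}"
    have lt: "Suc i mod ?n < ?n" "Suc j mod ?n < ?n" using p by (auto intro!: mod_less_divisor)
    \<comment> \<open>In the second case the two positions would be successors of each other, which
      needs a cycle of length 2.\<close>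
    have "i = j \<or> (i = Suc j mod ?n \<and> Suc i mod ?n = j)"
      using ij lt p(3) by (auto simp: doubleton_eq_iff nth_eq_iff_index_eq)
    then show "i = j" using ij p(2) by (auto simp: mod_Suc split: if_splits)
  qed
  moreover have "Z = (\<lambda>i. {p ! i, p ! (Suc i mod ?n)}) ` {..<?n}" using p unfolding cycle_edges_def by auto
  ultimately show ?thesis using distinct_card[OF p(3)] p(4) by (simp add: card_image)
qed

section \<open>Parity of the number of two-colourings\<close>

text \<open>Two-colourings without a bichromatic edge, given by the colour class that contains \<open>v0\<close>.
  Fixing the colour of \<open>v0\<close> makes their number \<open>2 ^ (c - 1)\<close> for \<open>c\<close> components, so that its parity
  detects connectedness.\<close>

definition cols :: "'a \<Rightarrow> 'a set \<Rightarrow> 'a set set \<Rightarrow> 'a set set" where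
  "cols v0 U Z = {C. C \<subseteq> U \<and> (v0 \<in> U \<longrightarrow> v0 \<in> C) \<and> (\<forall>e\<in>Z. e \<subseteq> C \<or> e \<inter> C = {})}"

lemma finite_cols: "finite U \<Longrightarrow> finite (cols v0 U Z)"
  by (rule finite_subset[of _ "Pow U"]) (auto simp: cols_def)

text \<open>In a connected graph the colour of \<open>v0\<close> spreads to all vertices, leaving
  one colouring. Otherwise, swapping the colours on all vertices that \<open>v0\<close> does not
  reach is an involution without fixed points.\<close>

lemma odd_card_cols_iff:
  assumes "finite V" "v0 \<in> V" and Z: "\<And>e. e \<in> Z \<Longrightarrow> e \<subseteq> V \<and> card e = 2"
  shows "odd (card (cols v0 V Z)) \<longleftrightarrow> connected_graph V Z"
proof -
  let ?R = "{(x, y). {x, y} \<in> Z}"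
  have symR: "sym (?R\<^sup>*)" by (intro sym_rtrancl) (auto simp: sym_def insert_commute)
  show ?thesis
  proof (cases "connected_graph V Z")
    case True
    have "C = V" if C: "C \<in> cols v0 V Z" for C
    proof
      show "V \<subseteq> C"
      proof
        fix u assume "u \<in> V"
        then have "(v0, u) \<in> ?R\<^sup>*" using True assms unfolding connected_graph_def by blast
        then show "u \<in> C"
        proof (induction rule: rtrancl_induct)
          case base show ?case using C assms unfolding cols_def by simp
        next
          case (step y z)
          then have "{y, z} \<subseteq> C \<or> {y, z} \<inter> C = {}" using C unfolding cols_def by auto
          then show ?case using step by auto
        qed
      qed
    qed (use C in \<open>auto simp: cols_def\<close>)
    moreover have "V \<in> cols v0 V Z" using Z assms unfolding cols_def by auto
    ultimately have "cols v0 V Z = {V}" by blast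
    then show ?thesis using True by simp
  next
    case False
    define K where "K = {u\<in>V. (v0, u) \<notin> ?R\<^sup>*}"
    have "K \<noteq> {}"
    proof
      assume "K = {}"
      then have "(v0, u) \<in> ?R\<^sup>*" if "u \<in> V" for u using that unfolding K_def by blast
      then have "(u, v) \<in> ?R\<^sup>*" if "u \<in> V" "v \<in> V" for u v using symR that by (meson rtrancl_trans symD)
      then show False using False assms unfolding connected_graph_def by blast
    qed
    then obtain k0 where k0: "k0 \<in> K" by blast
    have K: "K \<subseteq> V" "v0 \<notin> K" unfolding K_def by auto
    have Kc: "e \<subseteq> K \<or> e \<inter> K = {}" if e: "e \<in> Z" for e
    proof -
      obtain x y where xy: "e = {x, y}" using Z[OF e] card_2_iff by metis
      then have "(x, y) \<in> ?R" "(y, x) \<in> ?R" using e by (auto simp: insert_commute)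
      then have "(v0, x) \<in> ?R\<^sup>* \<longleftrightarrow> (v0, y) \<in> ?R\<^sup>*" by (meson rtrancl.rtrancl_into_rtrancl)
      then show ?thesis using xy Z[OF e] unfolding K_def by auto
    qed
    define \<tau> where "\<tau> C = (C - K) \<union> (K - C)" for C
    have t2: "\<tau> (\<tau> C) = C" for C unfolding \<tau>_def by blast
    have tc: "\<tau> C \<in> cols v0 V Z" if C: "C \<in> cols v0 V Z" for C
    proof -
      have "e \<subseteq> \<tau> C \<or> e \<inter> \<tau> C = {}" if e: "e \<in> Z" for e
        using Kc[OF e] C e unfolding cols_def \<tau>_def by blast
      then show ?thesis using C K assms unfolding cols_def \<tau>_def by auto
    qed
    have tk: "k0 \<in> \<tau> C \<longleftrightarrow> k0 \<notin> C" for C using k0 unfolding \<tau>_def by blast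
    let ?A = "{C\<in>cols v0 V Z. k0 \<in> C}" and ?B = "{C\<in>cols v0 V Z. k0 \<notin> C}"
    have "bij_betw \<tau> ?A ?B"
      by (rule bij_betw_byWitness[where f' = \<tau>]) (auto simp: t2 tc tk)
    then have "card ?A = card ?B" by (rule bij_betw_same_card)
    moreover have "card (cols v0 V Z) = card ?A + card ?B"
      using finite_cols[OF assms(1), of v0 Z]
      by (subst card_Un_disjoint[symmetric]) (auto intro!: arg_cong[of _ _ card])
    ultimately show ?thesis using False by simp
  qed
qed

text \<open>A colouring of the union is a pair of colourings with the same trace \<open>S\<close> on
  the common vertices. This is the factorisation of the compatibility matrix required by
  \<open>triangular_count\<close>, with one coordinate per trace.\<close>

lemma card_cols_Un:
  assumes "finite U1" "finite U2" and X: "\<And>e. e \<in> X \<Longrightarrow> e \<subseteq> U1" and Y: "\<And>e. e \<in> Y \<Longrightarrow> e \<subseteq> U2"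
  shows "card (cols v0 (U1 \<union> U2) (X \<union> Y)) = (\<Sum>S\<in>Pow (U1 \<inter> U2).
    card {C\<in>cols v0 U1 X. C \<inter> U2 = S} * card {C\<in>cols v0 U2 Y. C \<inter> U1 = S})"
proof -
  define L R where "L S = {C\<in>cols v0 U1 X. C \<inter> U2 = S}" and "R S = {C\<in>cols v0 U2 Y. C \<inter> U1 = S}" for S
  let ?D = "SIGMA S:Pow (U1 \<inter> U2). L S \<times> R S"
  have e1: "e \<subseteq> C \<inter> U1 \<longleftrightarrow> e \<subseteq> C" "e \<inter> (C \<inter> U1) = {} \<longleftrightarrow> e \<inter> C = {}" if "e \<in> X" for e C
    using X[OF that] by blast+
  have e2: "e \<subseteq> C \<inter> U2 \<longleftrightarrow> e \<subseteq> C" "e \<inter> (C \<inter> U2) = {} \<longleftrightarrow> e \<inter> C = {}" if "e \<in> Y" for e C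
    using Y[OF that] by blast+
  have fwd: "(C \<inter> U1 \<inter> U2, C \<inter> U1, C \<inter> U2) \<in> ?D" if "C \<in> cols v0 (U1 \<union> U2) (X \<union> Y)" for C
    using that e1 e2 unfolding L_def R_def cols_def by (auto simp: Int_assoc)
  have bwd: "C1 \<union> C2 \<in> cols v0 (U1 \<union> U2) (X \<union> Y) \<and> (C1 \<union> C2) \<inter> U1 = C1 \<and> (C1 \<union> C2) \<inter> U2 = C2 \<and> S = C1 \<inter> U2"
    if "(S, C1, C2) \<in> ?D" for S C1 C2
  proof -
    have c: "C1 \<in> cols v0 U1 X" "C2 \<in> cols v0 U2 Y" "C1 \<inter> U2 = S" "C2 \<inter> U1 = S"
      using that unfolding L_def R_def by auto
    then have sub: "C1 \<subseteq> U1" "C2 \<subseteq> U2" unfolding cols_def by auto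
    then have i: "(C1 \<union> C2) \<inter> U1 = C1" "(C1 \<union> C2) \<inter> U2 = C2" using c by blast+
    have "e \<subseteq> C1 \<union> C2 \<or> e \<inter> (C1 \<union> C2) = {}" if "e \<in> X \<union> Y" for e
      using that
    proof
      assume e: "e \<in> X"
      then have "e \<subseteq> C1 \<or> e \<inter> C1 = {}" using c unfolding cols_def by blast
      then show ?thesis using e1[OF e, of "C1 \<union> C2"] i by simp
    next
      assume e: "e \<in> Y"
      then have "e \<subseteq> C2 \<or> e \<inter> C2 = {}" using c unfolding cols_def by blast
      then show ?thesis using e2[OF e, of "C1 \<union> C2"] i by simp
    qed
    moreover have "v0 \<in> C1 \<union> C2" if "v0 \<in> U1 \<union> U2" using that c unfolding cols_def by auto
    ultimately have "C1 \<union> C2 \<in> cols v0 (U1 \<union> U2) (X \<union> Y)" using sub unfolding cols_def by blast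
    then show ?thesis using i c by simp
  qed
  have "bij_betw (\<lambda>C. (C \<inter> U1 \<inter> U2, C \<inter> U1, C \<inter> U2)) (cols v0 (U1 \<union> U2) (X \<union> Y)) ?D"
  proof (rule bij_betw_byWitness[where f' = "\<lambda>(S, C1, C2). C1 \<union> C2"])
    show "\<forall>C\<in>cols v0 (U1 \<union> U2) (X \<union> Y). (\<lambda>(S, C1, C2). C1 \<union> C2) (C \<inter> U1 \<inter> U2, C \<inter> U1, C \<inter> U2) = C"
      unfolding cols_def by auto
    show "\<forall>d\<in>?D. (\<lambda>C. (C \<inter> U1 \<inter> U2, C \<inter> U1, C \<inter> U2)) ((\<lambda>(S, C1, C2). C1 \<union> C2) d) = d"
    proof
      fix d assume d: "d \<in> ?D"
      obtain S C1 C2 where dd: "d = (S, C1, C2)" by (cases d)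
      show "(\<lambda>C. (C \<inter> U1 \<inter> U2, C \<inter> U1, C \<inter> U2)) ((\<lambda>(S, C1, C2). C1 \<union> C2) d) = d"
        using bwd[of S C1 C2] d dd by simp
    qed
    show "(\<lambda>C. (C \<inter> U1 \<inter> U2, C \<inter> U1, C \<inter> U2)) ` cols v0 (U1 \<union> U2) (X \<union> Y) \<subseteq> ?D"
      using fwd by blast
    show "(\<lambda>(S, C1, C2). C1 \<union> C2) ` ?D \<subseteq> cols v0 (U1 \<union> U2) (X \<union> Y)"
      using bwd by auto
  qed
  then have "card (cols v0 (U1 \<union> U2) (X \<union> Y)) = card ?D" by (rule bij_betw_same_card)
  also have "\<dots> = (\<Sum>S\<in>Pow (U1 \<inter> U2). card (L S \<times> R S))"
    unfolding L_def R_def using assms(1,2)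
    by (intro card_SigmaI ballI finite_cartesian_product) (simp_all add: finite_cols)
  finally show ?thesis unfolding L_def R_def by (simp add: card_cartesian_product)
qed

section \<open>Isolation on pieces\<close>

text \<open>The outside choice \<open>Y\<close> is fixed, so its weight is left out of the
  comparison.\<close>

definition minima :: "('e \<Rightarrow> nat) \<Rightarrow> 'e set set \<Rightarrow> 'e set \<Rightarrow> 'e set \<Rightarrow> 'e set set" where
  "minima \<omega> \<F> P Y = {X. X \<subseteq> P \<and> X \<union> Y \<in> \<F> \<and> (\<forall>X'\<subseteq>P. X' \<union> Y \<in> \<F> \<longrightarrow> sum \<omega> X \<le> sum \<omega> X')}"

text \<open>A piece \<open>P\<close> of the edge set is isolated if, for every way \<open>Y\<close> of choosing edges outside \<open>P\<close>,
  at most one lightest part inside \<open>P\<close> completes \<open>Y\<close>.\<close>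

definition isolated_on :: "('e \<Rightarrow> nat) \<Rightarrow> 'e set set \<Rightarrow> 'e set \<Rightarrow> 'e set \<Rightarrow> bool" where
  "isolated_on \<omega> \<F> E P \<longleftrightarrow> (\<forall>Y\<subseteq>E - P. \<forall>X\<in>minima \<omega> \<F> P Y. \<forall>X'\<in>minima \<omega> \<F> P Y. X = X')"

definition representatives :: "('e \<Rightarrow> nat) \<Rightarrow> 'e set set \<Rightarrow> 'e set \<Rightarrow> 'e set \<Rightarrow> 'e set set" where
  "representatives \<omega> \<F> E P = (\<Union>Y\<in>Pow (E - P). minima \<omega> \<F> P Y)"

lemma deg_Un:
  assumes "finite X" "finite Y" "X \<inter> Y = {}"
  shows "deg (X \<union> Y) v = deg X v + deg Y v"
proof -
  have "{e \<in> X \<union> Y. v \<in> e} = {e \<in> X. v \<in> e} \<union> {e \<in> Y. v \<in> e}" by auto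
  then show ?thesis unfolding deg_def by (simp only:) (rule card_Un_disjoint; use assms in auto)
qed

text \<open>The column of a representative \<open>X\<close> is an outside choice \<open>y X\<close>
  for which it is lightest. If a different \<open>X'\<close> of the same boundary degrees and no
  larger weight were compatible with \<open>y X\<close>, it would be a second lightest completion,
  against isolation. This makes the matrix triangular within each degree class.\<close>

lemma card_representatives_le:
  assumes G: "simple_graph V E" and P: "P \<subseteq> E" and iso: "isolated_on \<omega> (HC V E) E P"
  shows "card (representatives \<omega> (HC V E) E P) \<le> 6 ^ card (boundary E P)"
proof -
  let ?R = "representatives \<omega> (HC V E) E P" and ?B = "boundary E P"
  have finV: "finite V" and EV: "\<And>e. e \<in> E \<Longrightarrow> e \<subseteq> V \<and> card e = 2"
    using G unfolding simple_graph_def by auto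
  have finE: "finite E" using finV EV by (meson Pow_iff finite_Pow_iff finite_subset subsetI)
  have finB: "finite ?B" by (rule finite_subset[OF _ finV]) (use EV P in \<open>unfold boundary_def, blast\<close>)
  have finR: "finite ?R" using finE P
    by (intro finite_subset[of ?R "Pow E"]) (unfold representatives_def minima_def, blast, simp)
  show ?thesis
  proof (cases "HC V E = {}")
    case True
    then show ?thesis unfolding representatives_def minima_def by simp
  next
    case False
    then obtain Z where "Z \<in> HC V E" by blast
    then have "V \<noteq> {}" using HC_imp_hamiltonian[OF G] unfolding hamiltonian_def connected_graph_def by auto
    then obtain v0 where v0: "v0 \<in> V" by blast
    obtain y where "\<forall>X\<in>?R. y X \<subseteq> E - P \<and> X \<in> minima \<omega> (HC V E) P (y X)"
      using bchoice[of ?R "\<lambda>X Y. Y \<subseteq> E - P \<and> X \<in> minima \<omega> (HC V E) P Y"]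
      unfolding representatives_def by blast
    then have y: "y X \<subseteq> E - P" "X \<in> minima \<omega> (HC V E) P (y X)" if "X \<in> ?R" for X using that by blast+
    have XP: "X \<subseteq> P" "X \<union> y X \<in> HC V E" if "X \<in> ?R" for X
      using y(2)[OF that] unfolding minima_def by auto
    have ham: "Z \<in> HC V E \<longleftrightarrow> Z \<subseteq> E \<and> hamiltonian V Z" for Z using HC_iff_hamiltonian[OF G] .
    \<comment> \<open>Vertices without an edge of \<open>P\<close> all go to the outer side, so that
      the two sides cover \<open>V\<close> and meet exactly in the boundary.\<close>
    define U1 U2 where "U1 = \<Union>P" and "U2 = (V - \<Union>P) \<union> ?B"
    have U: "U1 \<union> U2 = V" "U1 \<inter> U2 = ?B" "U1 \<subseteq> V" "U2 \<subseteq> V"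
      using EV P unfolding U1_def U2_def boundary_def by auto
    have finU: "finite U1" "finite U2" using U finV finite_subset by blast+
    define f where "f X S = card {C\<in>cols v0 U1 X. C \<inter> U2 = S}" for X S
    define g where "g Y S = card {C\<in>cols v0 U2 Y. C \<inter> U1 = S}" for Y S
    have fg: "(\<Sum>S\<in>Pow ?B. f X S * g Y S) = card (cols v0 V (X \<union> Y))" if "X \<subseteq> P" "Y \<subseteq> E - P" for X Y
    proof -
      have "e \<subseteq> U1" if "e \<in> X" for e using that \<open>X \<subseteq> P\<close> unfolding U1_def by auto
      moreover have "e \<subseteq> U2" if "e \<in> Y" for e
        using that \<open>Y \<subseteq> E - P\<close> EV unfolding U2_def boundary_def by blast
      ultimately show ?thesis
        using card_cols_Un[OF finU, of X Y v0] U unfolding f_def g_def by simp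
    qed
    have odd: "odd (\<Sum>S\<in>Pow ?B. f X S * g Y S) \<longleftrightarrow> connected_graph V (X \<union> Y)"
      if "X \<subseteq> P" "Y \<subseteq> E - P" for X Y
      unfolding fg[OF that] using that EV P by (intro odd_card_cols_iff finV v0) auto
    \<comment> \<open>Parts of a Hamiltonian cycle have degrees 0, 1 or 2, which gives the factor 3
      per boundary vertex.\<close>
    define D where "D = ?B \<rightarrow>\<^sub>E {..2::nat}"
    have finD: "finite D" "card D = 3 ^ card ?B"
      unfolding D_def using finB by (auto simp: card_PiE intro: finite_PiE)
    define R where "R d = {X\<in>?R. restrict (deg X) ?B = d}" for d
    have degadd: "deg (X \<union> Y) v = deg X v + deg Y v" if "X \<subseteq> P" "Y \<subseteq> E - P" for X Y v
      using that finE P by (intro deg_Un) (auto intro: finite_subset)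
    have "card (R d) \<le> card (Pow ?B)" for d
    proof (rule triangular_count[where f = f and g = "\<lambda>X. g (y X)" and w = "sum \<omega>"])
      show "finite (R d)" "finite (Pow ?B)" using finR finB unfolding R_def by auto
    next
      fix X assume "X \<in> R d"
      then have X: "X \<in> ?R" unfolding R_def by simp
      have "connected_graph V (X \<union> y X)" using XP(2)[OF X] ham unfolding hamiltonian_def by blast
      then show "odd (\<Sum>S\<in>Pow ?B. f X S * g (y X) S)" using odd XP(1)[OF X] y(1)[OF X] by blast
    next
      fix X X' assume XX: "X \<in> R d" "X' \<in> R d" "X \<noteq> X'" "sum \<omega> X' \<le> sum \<omega> X"
      then have X: "X \<in> ?R" "X' \<in> ?R" and "restrict (deg X) ?B = restrict (deg X') ?B"
        unfolding R_def by auto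
      then have dB: "deg X v = deg X' v" if "v \<in> ?B" for v using that by (metis restrict_apply')
      show "even (\<Sum>S\<in>Pow ?B. f X' S * g (y X) S)"
      proof (rule ccontr)
        assume "\<not> ?thesis"
        then have conn: "connected_graph V (X' \<union> y X)" using odd XP(1)[OF X(2)] y(1)[OF X(1)] by blast
        have "deg X' v = deg X v" if v: "v \<in> V" for v
        proof -
          \<comment> \<open>Off the boundary degrees are forced: a vertex without edges in
            \<open>P\<close> has degree 0 in the part, and one without edges outside
            \<open>P\<close> has its full degree 2 there.\<close>
          consider "v \<in> ?B" | "v \<notin> \<Union>P" | "v \<notin> \<Union>(E - P)" unfolding boundary_def by blast
          then show ?thesis
          proof cases
            case 1 then show ?thesis using dB by simp
          next
            case 2
            then have "{e\<in>X. v \<in> e} = {}" "{e\<in>X'. v \<in> e} = {}" using XP(1) X by blast+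
            then show ?thesis unfolding deg_def by (simp only:)
          next
            case 3
            have "deg (y Q) v = 0" "deg (Q \<union> y Q) v = 2" if "Q \<in> ?R" for Q
            proof -
              have "{e\<in>y Q. v \<in> e} = {}" using 3 y(1)[OF that] by blast
              then show "deg (y Q) v = 0" unfolding deg_def by (simp only: card.empty)
              show "deg (Q \<union> y Q) v = 2" using XP(2)[OF that] ham v unfolding hamiltonian_def by blast
            qed
            then show ?thesis using degadd[OF XP(1) y(1)] X by (metis add.right_neutral)
          qed
        qed
        then have "deg (X' \<union> y X) v = deg (X \<union> y X) v" if "v \<in> V" for v
          using that degadd XP(1) y(1) X by simp
        then have "hamiltonian V (X' \<union> y X)"
          using conn XP(2)[OF X(1)] ham unfolding hamiltonian_def by simp
        then have H: "X' \<union> y X \<in> HC V E" using ham XP(1)[OF X(2)] y(1)[OF X(1)] P by blast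
        then have "X' \<in> minima \<omega> (HC V E) P (y X)"
          using y(2)[OF X(1)] XX(4) XP(1)[OF X(2)] unfolding minima_def by (auto intro: order_trans)
        then show False using iso y[OF X(1)] XX(3) unfolding isolated_on_def by blast
      qed
    qed
    moreover have "?R \<subseteq> (\<Union>d\<in>D. R d)"
    proof
      fix X assume X: "X \<in> ?R"
      have "deg X v \<le> 2" if "v \<in> ?B" for v
      proof -
        have "v \<in> V" using that U by blast
        then have "deg (X \<union> y X) v = 2" using XP(2)[OF X] ham unfolding hamiltonian_def by blast
        then show ?thesis using degadd[OF XP(1)[OF X] y(1)[OF X]] by (metis le_add1)
      qed
      then have "restrict (deg X) ?B \<in> D" unfolding D_def by auto
      then show "X \<in> (\<Union>d\<in>D. R d)" using X unfolding R_def by blast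
    qed
    ultimately have "card ?R \<le> (\<Sum>d\<in>D. card (Pow ?B))"
      using finD(1) finR unfolding R_def
      by (intro order_trans[OF card_mono order_trans[OF card_UN_le sum_mono]]) auto
    also have "\<dots> = 3 ^ card ?B * 2 ^ card ?B" using finB finD by (simp add: card_Pow)
    also have "\<dots> = 6 ^ card ?B" by (simp add: power_mult_distrib[symmetric])
    finally show ?thesis .
  qed
qed

text \<open>Two completions of the same \<open>Y\<close> have equally many edges, which determines a
  subset of a piece with at most one edge.\<close>

lemma isolated_on_small:
  assumes "finite E" "P \<subseteq> E" "card P \<le> 1" and same: "\<And>Z. Z \<in> \<F> \<Longrightarrow> card Z = n"
  shows "isolated_on \<omega> \<F> E P"
  unfolding isolated_on_def
proof (intro allI impI ballI)
  fix Y X X' assume Y: "Y \<subseteq> E - P" and X: "X \<in> minima \<omega> \<F> P Y" "X' \<in> minima \<omega> \<F> P Y"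
  have fin: "finite P" "finite Y" using assms Y finite_subset by blast+
  have sub: "X \<subseteq> P" "X' \<subseteq> P" "X \<union> Y \<in> \<F>" "X' \<union> Y \<in> \<F>" using X unfolding minima_def by auto
  have "card (Q \<union> Y) = card Q + card Y" if "Q \<subseteq> P" for Q
    using that fin Y finite_subset by (intro card_Un_disjoint) blast+
  then have "card X = card X'" using same sub by (metis add_right_cancel)
  obtain e where "P \<subseteq> {e}" using assms(3) fin card_le_Suc0_iff_eq[of P]
    by (metis One_nat_def insertI1 subsetI)
  then have "X \<in> {{}, {e}}" "X' \<in> {{}, {e}}" using sub by (auto simp: subset_singleton_iff)
  then show "X = X'" using \<open>card X = card X'\<close> by auto
qed

text \<open>Since \<open>K\<close> exceeds every total of \<open>h\<close>, the new weights compare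
  lexicographically, and their minima are also minima for \<open>\<omega>\<close>. Each such minimum
  is a union of representatives of the two halves. All minima have equal old and new weights, hence
  equal hashes, and the hash is injective on these unions.\<close>

lemma isolated_on_merge:
  fixes \<omega> h :: "'e \<Rightarrow> nat"
  assumes E: "finite E" and P: "P1 \<union> P2 \<subseteq> E" "P1 \<inter> P2 = {}" and h: "sum h E < K"
    and inj: "inj_on (sum h) {X1 \<union> X2 | X1 X2. X1 \<in> representatives \<omega> \<F> E P1 \<and> X2 \<in> representatives \<omega> \<F> E P2}"
  shows "isolated_on (\<lambda>e. K * \<omega> e + h e) \<F> E (P1 \<union> P2)"
  unfolding isolated_on_def
proof (intro allI impI ballI)
  let ?w = "\<lambda>e. K * \<omega> e + h e" and ?P = "P1 \<union> P2"
  fix Y X X' assume Y: "Y \<subseteq> E - ?P" and X: "X \<in> minima ?w \<F> ?P Y" "X' \<in> minima ?w \<F> ?P Y"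
  have w: "sum ?w Q = K * sum \<omega> Q + sum h Q" for Q by (simp add: sum.distrib sum_distrib_left)
  have hK: "sum h Q < K" if "Q \<subseteq> E" for Q
    using h sum_mono2[OF E that, of h] by simp
  have min: "Q \<in> minima \<omega> \<F> ?P Y" if Q: "Q \<in> minima ?w \<F> ?P Y" for Q
  proof -
    have "sum \<omega> Q \<le> sum \<omega> Q'" if "Q' \<subseteq> ?P" "Q' \<union> Y \<in> \<F>" for Q'
    proof -
      have "K * sum \<omega> Q + sum h Q \<le> K * sum \<omega> Q' + sum h Q'"
        using Q that unfolding minima_def w by blast
      moreover have "sum h Q' < K" using hK that(1) P(1) by (meson order_trans)
      ultimately have "K * sum \<omega> Q + sum h Q < K * sum \<omega> Q' + K" by linarith
      also have "\<dots> = K * Suc (sum \<omega> Q')" by simp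
      finally have "K * sum \<omega> Q < K * Suc (sum \<omega> Q')" by linarith
      then have "sum \<omega> Q < Suc (sum \<omega> Q')" using mult_less_cancel1 by blast
      then show ?thesis by simp
    qed
    then show ?thesis using Q unfolding minima_def by blast
  qed
  \<comment> \<open>Exchange argument: with the rest of \<open>Q\<close> counted as outside choice,
    a lighter replacement for \<open>Q \<inter> A\<close> would make \<open>Q\<close> itself
    lighter.\<close>
  have part: "Q \<inter> A \<in> representatives \<omega> \<F> E A"
    if Q: "Q \<in> minima \<omega> \<F> ?P Y" and A: "?P = A \<union> B" "A \<inter> B = {}" for Q A B
  proof -
    have QP: "Q \<subseteq> ?P" "Q \<union> Y \<in> \<F>" using Q unfolding minima_def by auto
    have finQ: "finite Q" using QP P E by (meson finite_subset order_trans)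
    have "Q \<inter> A \<in> minima \<omega> \<F> A (Q \<inter> B \<union> Y)"
    proof -
      have "Q \<inter> A \<union> (Q \<inter> B \<union> Y) = Q \<union> Y" using QP A by blast
      moreover have "sum \<omega> (Q \<inter> A) \<le> sum \<omega> X1" if X1: "X1 \<subseteq> A" "X1 \<union> (Q \<inter> B \<union> Y) \<in> \<F>" for X1
      proof -
        have "X1 \<union> Q \<inter> B \<subseteq> ?P" "(X1 \<union> Q \<inter> B) \<union> Y \<in> \<F>" using X1 A by (auto simp: Un_assoc)
        then have "sum \<omega> Q \<le> sum \<omega> (X1 \<union> Q \<inter> B)" using Q unfolding minima_def by blast
        also have "\<dots> = sum \<omega> X1 + sum \<omega> (Q \<inter> B)"
          using X1 A finQ P E by (intro sum.union_disjoint) (auto intro: finite_subset)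
        finally have "sum \<omega> Q \<le> sum \<omega> X1 + sum \<omega> (Q \<inter> B)" .
        moreover have "sum \<omega> Q = sum \<omega> (Q \<inter> A) + sum \<omega> (Q \<inter> B)"
        proof -
          have "Q = (Q \<inter> A) \<union> (Q \<inter> B)" using QP A by blast
          then show ?thesis using A finQ
            by (metis (no_types, lifting) finite_Int inf_commute inf_left_commute inf_bot_right sum.union_disjoint)
        qed
        ultimately show ?thesis by simp
      qed
      ultimately show ?thesis using QP unfolding minima_def by auto
    qed
    moreover have "Q \<inter> B \<union> Y \<subseteq> E - A" using A P Y by blast
    ultimately show ?thesis unfolding representatives_def by blast
  qed
  let ?C = "{X1 \<union> X2 | X1 X2. X1 \<in> representatives \<omega> \<F> E P1 \<and> X2 \<in> representatives \<omega> \<F> E P2}"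
  have C: "Q \<in> ?C" if Q: "Q \<in> minima ?w \<F> ?P Y" for Q
  proof -
    have "Q = (Q \<inter> P1) \<union> (Q \<inter> P2)" using Q unfolding minima_def by blast
    moreover have "Q \<inter> P1 \<in> representatives \<omega> \<F> E P1" using part[OF min[OF Q], of P1 P2] P by blast
    moreover have "Q \<inter> P2 \<in> representatives \<omega> \<F> E P2" using part[OF min[OF Q], of P2 P1] P by blast
    ultimately show ?thesis by blast
  qed
  have eq: "sum f X = sum f X'" if "X \<in> minima f \<F> ?P Y" "X' \<in> minima f \<F> ?P Y" for f
    using that unfolding minima_def by (intro antisym) auto
  have "sum ?w X = sum ?w X'" "sum \<omega> X = sum \<omega> X'"
    using eq[OF X] eq[OF min[OF X(1)] min[OF X(2)]] by auto
  then have "sum h X = sum h X'" unfolding w by simp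
  then show "X = X'" by (rule inj_onD[OF inj _ C[OF X(1)] C[OF X(2)]])
qed

section \<open>The scheme\<close>

text \<open>A base-\<open>K\<close> numeral in which the head of the list, the latest prime,
  supplies the least significant digit and so only breaks ties left by the earlier primes.\<close>

primrec hash_weight :: "nat \<Rightarrow> nat list \<Rightarrow> nat \<Rightarrow> nat" where
  "hash_weight K [] e = 0"
| "hash_weight K (p # ps) e = K * hash_weight K ps e + 2 ^ e mod p"

lemma hash_weight_less:
  "\<forall>p\<in>set ps. 0 < p \<and> p \<le> K \<Longrightarrow> hash_weight K ps e < K ^ length ps"
proof (induction ps)
  case (Cons p ps)
  then have "Suc (hash_weight K ps e) \<le> K ^ length ps" by simp
  then have "K * Suc (hash_weight K ps e) \<le> K * K ^ length ps" by (rule mult_le_mono2)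
  moreover have "2 ^ e mod p < K" using Cons.prems mod_less_divisor[of p "2 ^ e"] by fastforce
  ultimately show ?case by simp
qed simp

text \<open>A union bound: each of at most \<open>s\<close> pieces has at most
  \<open>6 ^ (2 * b)\<close> candidates from its two halves, hence at most
  \<open>6 ^ (4 * b)\<close> pairs to be separated, and each pair is confused by at most
  \<open>Suc m\<close> primes.\<close>

lemma card_bad_primes_le:
  fixes \<phi> :: "'a set \<Rightarrow> nat"
  assumes G: "simple_graph V E" and "finite E" and \<phi>: "inj_on \<phi> E" "\<phi> ` E \<subseteq> {..m}"
    and P: "finite P" "\<And>p. p \<in> P \<Longrightarrow> prime p \<and> p \<le> N" and K: "card E * N < K"
    and \<Q>: "finite \<Q>" "card \<Q> \<le> s"
    and split: "\<And>Q. Q \<in> \<Q> \<Longrightarrow> \<exists>Q1\<in>\<R>. \<exists>Q2\<in>\<R>. Q = Q1 \<union> Q2 \<and> Q1 \<inter> Q2 = {}"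
    and \<R>: "\<And>Q. Q \<in> \<R> \<Longrightarrow> Q \<subseteq> E \<and> card (boundary E Q) \<le> b \<and> isolated_on \<omega> (HC V E) E Q"
  shows "card {p\<in>P. \<not> (\<forall>Q\<in>\<Q>. isolated_on (\<lambda>e. K * \<omega> e + 2 ^ \<phi> e mod p) (HC V E) E Q)}
    \<le> s * 6 ^ (4 * b) * Suc m"
proof -
  let ?rep = "representatives \<omega> (HC V E) E"
  have "\<exists>Q1 Q2. Q1 \<in> \<R> \<and> Q2 \<in> \<R> \<and> Q = Q1 \<union> Q2 \<and> Q1 \<inter> Q2 = {}" if "Q \<in> \<Q>" for Q
    using split[OF that] by blast
  then obtain l r where lr: "\<And>Q. Q \<in> \<Q> \<Longrightarrow> l Q \<in> \<R> \<and> r Q \<in> \<R> \<and> Q = l Q \<union> r Q \<and> l Q \<inter> r Q = {}"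
    by metis
  define C where "C Q = {X1 \<union> X2 | X1 X2. X1 \<in> ?rep (l Q) \<and> X2 \<in> ?rep (r Q)}" for Q
  have rep: "finite (?rep Q)" "card (?rep Q) \<le> 6 ^ b" "?rep Q \<subseteq> Pow E" if "Q \<in> \<R>" for Q
  proof -
    show sub: "?rep Q \<subseteq> Pow E"
      using \<R>[OF that] unfolding representatives_def minima_def by blast
    show "finite (?rep Q)" using sub \<open>finite E\<close> by (simp add: finite_subset)
    have "card (?rep Q) \<le> 6 ^ card (boundary E Q)"
      using card_representatives_le[OF G] \<R>[OF that] by blast
    also have "\<dots> \<le> 6 ^ b" using \<R>[OF that] by (intro power_increasing) auto
    finally show "card (?rep Q) \<le> 6 ^ b" .
  qed
  have C: "finite (C Q)" "card (C Q) \<le> 6 ^ (2 * b)" "\<And>X. X \<in> C Q \<Longrightarrow> X \<subseteq> E" if Q: "Q \<in> \<Q>" for Q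
  proof -
    have im: "C Q = (\<lambda>(X1, X2). X1 \<union> X2) ` (?rep (l Q) \<times> ?rep (r Q))" unfolding C_def by auto
    note L = rep[of "l Q"] and R = rep[of "r Q"]
    show "finite (C Q)" unfolding im using L(1) R(1) lr[OF Q] by simp
    have "card (C Q) \<le> card (?rep (l Q) \<times> ?rep (r Q))"
      unfolding im using L(1) R(1) lr[OF Q] by (intro card_image_le) simp
    also have "\<dots> \<le> 6 ^ b * 6 ^ b"
      unfolding card_cartesian_product using L(2) R(2) lr[OF Q] by (intro mult_le_mono) auto
    finally show "card (C Q) \<le> 6 ^ (2 * b)" by (simp add: power_add mult_2)
    show "X \<subseteq> E" if X: "X \<in> C Q" for X
    proof -
      obtain X1 X2 where "X = X1 \<union> X2" "X1 \<in> ?rep (l Q)" "X2 \<in> ?rep (r Q)" using X unfolding C_def by blast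
      then show ?thesis using L(3) R(3) lr[OF Q] by auto
    qed
  qed
  define h where "h p e = 2 ^ \<phi> e mod p" for p :: nat and e
  define coll where "coll X Y = {p\<in>P. sum (h p) X = sum (h p) Y}" for X Y
  define T where "T Q = {XY \<in> C Q \<times> C Q. fst XY \<noteq> snd XY}" for Q
  have T: "finite (T Q)" "card (T Q) \<le> 6 ^ (4 * b)" if "Q \<in> \<Q>" for Q
  proof -
    show "finite (T Q)" using C(1)[OF that] unfolding T_def by simp
    have "card (T Q) \<le> card (C Q \<times> C Q)" using C(1)[OF that] unfolding T_def by (intro card_mono) auto
    also have "\<dots> \<le> 6 ^ (2 * b) * 6 ^ (2 * b)"
      unfolding card_cartesian_product using C(2)[OF that] by (intro mult_le_mono)
    finally show "card (T Q) \<le> 6 ^ (4 * b)" by (simp add: power_add[symmetric])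
  qed
  let ?bad = "{p\<in>P. \<not> (\<forall>Q\<in>\<Q>. isolated_on (\<lambda>e. K * \<omega> e + 2 ^ \<phi> e mod p) (HC V E) E Q)}"
  have sub: "?bad \<subseteq> (\<Union>Q\<in>\<Q>. \<Union>XY\<in>T Q. coll (fst XY) (snd XY))"
  proof
    fix p assume "p \<in> ?bad"
    then obtain Q where p: "p \<in> P" and Q: "Q \<in> \<Q>" "\<not> isolated_on (\<lambda>e. K * \<omega> e + h p e) (HC V E) E Q"
      unfolding h_def by blast
    have "0 < p" using P(2)[OF p] prime_gt_0_nat by blast
    have "sum (h p) E \<le> (\<Sum>e\<in>E. N)"
      using P(2)[OF p] \<open>0 < p\<close> unfolding h_def
      by (intro sum_mono) (meson less_imp_le mod_less_divisor order_trans)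
    then have hK: "sum (h p) E < K" using K by simp
    have q: "l Q \<union> r Q \<subseteq> E" "l Q \<inter> r Q = {}" "l Q \<union> r Q = Q" using lr[OF Q(1)] \<R>[of "l Q"] \<R>[of "r Q"] by blast+
    have "\<not> inj_on (sum (h p)) (C Q)"
      using isolated_on_merge[OF \<open>finite E\<close> q(1,2) hK, of \<omega> "HC V E"] Q(2) unfolding C_def q(3) by blast
    then obtain X Y where "X \<in> C Q" "Y \<in> C Q" "X \<noteq> Y" "sum (h p) X = sum (h p) Y"
      unfolding inj_on_def by blast
    then have "(X, Y) \<in> T Q" "p \<in> coll X Y" using p unfolding T_def coll_def by auto
    then show "p \<in> (\<Union>Q\<in>\<Q>. \<Union>XY\<in>T Q. coll (fst XY) (snd XY))" using Q(1) by force
  qed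
  have "card ?bad \<le> card (\<Union>Q\<in>\<Q>. \<Union>XY\<in>T Q. coll (fst XY) (snd XY))"
    using sub P(1) T(1) \<Q>(1) by (intro card_mono) (auto simp: coll_def)
  also have "\<dots> \<le> (\<Sum>Q\<in>\<Q>. card (\<Union>XY\<in>T Q. coll (fst XY) (snd XY)))" using \<Q>(1) by (rule card_UN_le)
  also have "\<dots> \<le> (\<Sum>Q\<in>\<Q>. 6 ^ (4 * b) * Suc m)"
  proof (intro sum_mono)
    fix Q assume Q: "Q \<in> \<Q>"
    have "card (\<Union>XY\<in>T Q. coll (fst XY) (snd XY)) \<le> (\<Sum>XY\<in>T Q. card (coll (fst XY) (snd XY)))"
      using T(1)[OF Q] by (rule card_UN_le)
    also have "\<dots> \<le> (\<Sum>XY\<in>T Q. Suc m)"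
    proof (intro sum_mono)
      fix XY assume "XY \<in> T Q"
      then have "fst XY \<in> C Q" "snd XY \<in> C Q" "fst XY \<noteq> snd XY" unfolding T_def by auto
      then show "card (coll (fst XY) (snd XY)) \<le> Suc m"
        unfolding coll_def h_def using C(3)[OF Q] P
        by (intro card_colliding_primes_le[OF \<open>finite E\<close> \<phi>]) simp_all
    qed
    also have "\<dots> = card (T Q) * Suc m" by simp
    also have "\<dots> \<le> 6 ^ (4 * b) * Suc m" using T(2)[OF Q] by (rule mult_le_mono1)
    finally show "card (\<Union>XY\<in>T Q. coll (fst XY) (snd XY)) \<le> 6 ^ (4 * b) * Suc m" .
  qed
  also have "\<dots> = card \<Q> * (6 ^ (4 * b) * Suc m)" by simp
  also have "\<dots> \<le> s * (6 ^ (4 * b) * Suc m)" using \<Q>(2) by (rule mult_le_mono1)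
  finally show ?thesis by (simp only: mult.assoc)
qed

text \<open>For the piece consisting of all edges, the empty set is the only outside choice.\<close>

lemma isolates_if_isolated_on:
  assumes iso: "isolated_on \<omega> \<F> E E" and "\<F> \<subseteq> Pow E" "\<F> \<noteq> {}"
  shows "isolates \<omega> \<F>"
proof -
  have min: "X \<in> minima \<omega> \<F> E {} \<longleftrightarrow> X \<in> \<F> \<and> (\<forall>Y\<in>\<F>. sum \<omega> X \<le> sum \<omega> Y)" for X
    using assms(2) unfolding minima_def by auto
  obtain X0 where "X0 \<in> \<F>" using assms(3) by blast
  then obtain X where X: "X \<in> \<F>" "\<forall>Y. Y \<in> \<F> \<longrightarrow> sum \<omega> X \<le> sum \<omega> Y"
    using ex_has_least_nat[of "\<lambda>X. X \<in> \<F>" X0 "sum \<omega>"] by blast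
  then have XM: "X \<in> minima \<omega> \<F> E {}" using min by blast
  have "Y = X" if "Y \<in> minima \<omega> \<F> E {}" for Y
    using iso XM that unfolding isolated_on_def by blast
  then have "\<exists>!X. X \<in> minima \<omega> \<F> E {}" using XM by blast
  then show ?thesis unfolding isolates_def min .
qed

text \<open>A list of \<open>i\<close> primes counts as good if its weights isolate all pieces of
  level \<open>i\<close>. The hypothesis on \<open>card P\<close> says that the bad extensions of a
  good list are at most a fraction 1/(2L) of the primes.\<close>

lemma half_of_hash_weights_isolate:
  fixes \<phi> :: "'a set \<Rightarrow> nat"
  assumes G: "simple_graph V E" and "finite E" and \<phi>: "inj_on \<phi> E" "\<phi> ` E \<subseteq> {..m}"
    and P: "finite P" "\<And>p. p \<in> P \<Longrightarrow> prime p \<and> p \<le> N" and K: "card E * N < K"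
    and H: "hierarchy E b L E" and large: "2 * L * (2 ^ L * 6 ^ (4 * b) * Suc m) \<le> card P"
    and ne: "HC V E \<noteq> {}"
  shows "card P ^ L \<le>
    2 * card {ps. set ps \<subseteq> P \<and> length ps = L \<and> isolates (hash_weight K ps \<circ> \<phi>) (HC V E)}"
proof -
  obtain \<P> where "splitting_levels E b L E \<P>" using splitting_levels_exists[OF H] by blast
  then have \<P>: "\<P> L = {E}" "\<And>i. i \<le> L \<Longrightarrow> finite (\<P> i) \<and> card (\<P> i) \<le> 2 ^ (L - i)"
    "\<And>i Q. i \<le> L \<Longrightarrow> Q \<in> \<P> i \<Longrightarrow> Q \<subseteq> E \<and> card (boundary E Q) \<le> b"
    "\<And>Q. Q \<in> \<P> 0 \<Longrightarrow> card Q \<le> 1"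
    "\<And>i Q. i < L \<Longrightarrow> Q \<in> \<P> (Suc i) \<Longrightarrow> \<exists>Q1\<in>\<P> i. \<exists>Q2\<in>\<P> i. Q = Q1 \<union> Q2 \<and> Q1 \<inter> Q2 = {}"
    unfolding splitting_levels_def by simp_all
  define good where
    "good ps \<longleftrightarrow> (\<forall>Q\<in>\<P> (length ps). isolated_on (hash_weight K ps \<circ> \<phi>) (HC V E) E Q)" for ps
  define \<beta> where "\<beta> = 2 ^ L * 6 ^ (4 * b) * Suc m"
  have "good []"
    unfolding good_def
  proof
    fix Q assume Q: "Q \<in> \<P> (length [])"
    then have "Q \<subseteq> E" "card Q \<le> 1" using \<P>(3)[of 0 Q] \<P>(4)[of Q] by auto
    then show "isolated_on (hash_weight K [] \<circ> \<phi>) (HC V E) E Q"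
      using isolated_on_small[OF \<open>finite E\<close>] card_HC by blast
  qed
  have step: "card {p\<in>P. \<not> good (p # ps)} \<le> \<beta>" if ps: "length ps < L" "good ps" for ps
  proof -
    let ?i = "length ps"
    have *: "(hash_weight K (p # ps) \<circ> \<phi>) = (\<lambda>e. K * (hash_weight K ps \<circ> \<phi>) e + 2 ^ \<phi> e mod p)" for p
      by (simp add: fun_eq_iff)
    have "card {p\<in>P. \<not> (\<forall>Q\<in>\<P> (Suc ?i). isolated_on (\<lambda>e. K * (hash_weight K ps \<circ> \<phi>) e + 2 ^ \<phi> e mod p) (HC V E) E Q)}
      \<le> 2 ^ (L - Suc ?i) * 6 ^ (4 * b) * Suc m"
    proof (rule card_bad_primes_le[OF G \<open>finite E\<close> \<phi> P K, where \<R> = "\<P> ?i"])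
      show "finite (\<P> (Suc ?i))" "card (\<P> (Suc ?i)) \<le> 2 ^ (L - Suc ?i)" using \<P>(2)[of "Suc ?i"] ps by auto
      show "\<exists>Q1\<in>\<P> ?i. \<exists>Q2\<in>\<P> ?i. Q = Q1 \<union> Q2 \<and> Q1 \<inter> Q2 = {}" if "Q \<in> \<P> (Suc ?i)" for Q
        using \<P>(5)[OF ps(1) that] .
      show "Q \<subseteq> E \<and> card (boundary E Q) \<le> b \<and> isolated_on (hash_weight K ps \<circ> \<phi>) (HC V E) E Q"
        if "Q \<in> \<P> ?i" for Q
        using \<P>(3)[of ?i Q] that ps unfolding good_def by auto
    qed
    also have "\<dots> \<le> \<beta>" unfolding \<beta>_def by (intro mult_le_mono power_increasing) auto
    finally show ?thesis unfolding good_def * by simp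
  qed
  have "card P ^ L \<le> 2 * (card P - \<beta>) ^ L"
    using large unfolding \<beta>_def by (rule half_power_le_power_diff)
  also have "(card P - \<beta>) ^ L \<le> card {ps. set ps \<subseteq> P \<and> length ps = L \<and> good ps}"
    by (rule card_good_lists_ge[OF P(1) \<open>good []\<close> step order_refl])
  also have "\<dots> \<le> card {ps. set ps \<subseteq> P \<and> length ps = L \<and> isolates (hash_weight K ps \<circ> \<phi>) (HC V E)}"
  proof (rule card_mono)
    show "finite {ps. set ps \<subseteq> P \<and> length ps = L \<and> isolates (hash_weight K ps \<circ> \<phi>) (HC V E)}"
      by (rule finite_subset[OF _ finite_lists_length_eq[OF P(1), of L]]) auto
    have "HC V E \<subseteq> Pow E" using HC_imp_hamiltonian[OF G] by blast
    then have "isolates (hash_weight K ps \<circ> \<phi>) (HC V E)" if "good ps" "length ps = L" for ps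
      using that ne \<P>(1) unfolding good_def by (intro isolates_if_isolated_on) auto
    then show "{ps. set ps \<subseteq> P \<and> length ps = L \<and> good ps}
      \<subseteq> {ps. set ps \<subseteq> P \<and> length ps = L \<and> isolates (hash_weight K ps \<circ> \<phi>) (HC V E)}" by blast
  qed
  finally show ?thesis by simp
qed

lemma tree_decomposition_hierarchy:
  assumes "simple_graph V E" "V \<noteq> {}" "treewidth V E \<le> t" "2 ^ j * card E \<le> 3 ^ j"
  shows "hierarchy E (6 * Suc t) (2 * j) E"
proof -
  obtain I :: "nat set" and F bag where "tree_decomposition V E I F bag"
    "\<And>x. x \<in> I \<Longrightarrow> card (bag x) \<le> Suc t"
    using treewidth_tree_decomposition[OF assms(1-3)] by metis
  then interpret bounded_tree_decomposition V E I F bag "Suc t"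
    using assms by unfold_locales auto
  show ?thesis using assms(4) by (intro hierarchy_exists) auto
qed

lemma simple_graph_edges:
  assumes "simple_graph V E"
  shows "finite E" "card E \<le> (card V)\<^sup>2"
proof -
  have V: "finite V" and E: "\<And>e. e \<in> E \<Longrightarrow> e \<subseteq> V \<and> card e = 2" using assms unfolding simple_graph_def by auto
  have sub: "E \<subseteq> (\<lambda>(u, v). {u, v}) ` (V \<times> V)"
  proof
    fix e assume e: "e \<in> E"
    then obtain u v where "e = {u, v}" using E card_2_iff by metis
    then show "e \<in> (\<lambda>(u, v). {u, v}) ` (V \<times> V)" using E[OF e] by auto
  qed
  then show "finite E" using V by (meson finite_SigmaI finite_imageI finite_subset)
  have "card E \<le> card ((\<lambda>(u, v). {u, v}) ` (V \<times> V))" using sub V by (intro card_mono) auto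
  also have "\<dots> \<le> card (V \<times> V)" using V by (intro card_image_le) auto
  finally show "card E \<le> (card V)\<^sup>2" by (simp add: card_cartesian_product power2_eq_square)
qed

section \<open>Parameters of the scheme\<close>

definition levels :: "nat \<Rightarrow> nat" where "levels n = nat \<lceil>log 2 (real n)\<rceil>"

text \<open>With \<open>k = levels n\<close> and \<open>b = 6 (t + 1)\<close>, the scheme uses \<open>8 k\<close> levels, and the exponent is
  chosen such that
  \<open>2 * 8k * (2 ^ (8k) * 6 ^ (4b) * (m + 1)) \<le> 2 ^ (k + 4) * 2 ^ (8k) * 2 ^ (12b) * 2 ^ (2k + 1)\<close>,
  the number of primes required by \<open>half_of_hash_weights_isolate\<close>.\<close>

definition prime_bits :: "nat \<Rightarrow> nat \<Rightarrow> nat" where "prime_bits t n = 11 * levels n + 72 * Suc t + 5"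

definition scheme_primes :: "nat \<Rightarrow> nat \<Rightarrow> nat set" where
  "scheme_primes t n = {p. prime p \<and> p \<le> 2 ^ (2 * prime_bits t n)}"

text \<open>The base exceeds the total hash weight of at most \<open>2 ^ (2 * levels n)\<close> edges.\<close>

definition scheme_base :: "nat \<Rightarrow> nat \<Rightarrow> nat" where
  "scheme_base t n = 2 ^ (2 * levels n + 2 * prime_bits t n + 1)"

text \<open>Outside the guard there is no graph with a Hamiltonian cycle to serve, so a single zero
  weight suffices; it meets the bounds even where \<open>log 2 n\<close> vanishes.\<close>

definition scheme :: "nat \<Rightarrow> nat \<Rightarrow> nat \<Rightarrow> (nat \<Rightarrow> nat) list" where
  "scheme t n m = (if 3 \<le> n \<and> m \<le> n\<^sup>2
     then map (hash_weight (scheme_base t n))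
       (List.n_lists (8 * levels n) (sorted_list_of_set (scheme_primes t n)))
     else [\<lambda>_. 0])"

lemma le_two_power_levels: "n \<ge> 1 \<Longrightarrow> n \<le> 2 ^ levels n"
proof -
  assume n: "n \<ge> 1"
  have "real n = 2 powr (log 2 (real n))" using n by simp
  also have "\<dots> \<le> 2 powr (real (levels n))" unfolding levels_def by (intro powr_mono) linarith+
  also have "\<dots> = real (2 ^ levels n)" by (simp add: powr_realpow)
  finally show ?thesis by (simp only: of_nat_le_iff)
qed

lemma levels_le: "n \<ge> 2 \<Longrightarrow> real (levels n) \<le> 2 * log 2 (real n)"
proof -
  assume "n \<ge> 2"
  then have "log 2 (real n) \<ge> 1" by (subst le_log_iff) auto
  then show ?thesis unfolding levels_def by linarith
qed

lemma scheme_primes: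
  "finite (scheme_primes t n)"
  "p \<in> scheme_primes t n \<Longrightarrow> prime p \<and> p \<le> 2 ^ (2 * prime_bits t n)"
  "2 ^ prime_bits t n \<le> card (scheme_primes t n)"
  "card (scheme_primes t n) \<le> 2 ^ (2 * prime_bits t n)"
proof -
  have sub: "scheme_primes t n \<subseteq> {1..2 ^ (2 * prime_bits t n)}"
    unfolding scheme_primes_def by (auto dest: prime_ge_1_nat)
  then show "finite (scheme_primes t n)" by (rule finite_subset) simp
  show "card (scheme_primes t n) \<le> 2 ^ (2 * prime_bits t n)" using card_mono[OF _ sub] by simp
  show "2 ^ prime_bits t n \<le> card (scheme_primes t n)"
    unfolding scheme_primes_def by (rule card_primes_ge) (simp add: prime_bits_def)
qed (simp add: scheme_primes_def)

lemma scheme_isolates: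
  assumes G: "simple_graph V E" and tw: "treewidth V E \<le> t" and n: "card V = n"
    and bij: "bij_betw \<phi> E {1..m}" and ne: "HC V E \<noteq> {}"
  shows "length (scheme t n m) \<le> 2 * length (filter (\<lambda>\<omega>. isolates (\<omega> \<circ> \<phi>) (HC V E)) (scheme t n m))"
proof -
  define k where "k = levels n"
  have finE: "finite E" and En: "card E \<le> n\<^sup>2" using simple_graph_edges[OF G] n by auto
  have Em: "card E = m" using bij_betw_same_card[OF bij] by simp
  obtain p where p: "3 \<le> length p" "distinct p" "set p = V"
    using ne unfolding HC_def is_cycle_def by blast
  then have n3: "3 \<le> n" using n distinct_card by fastforce
  have Vne: "V \<noteq> {}" using p by auto
  have "n \<le> 2 ^ k" using le_two_power_levels n3 unfolding k_def by simp
  then have "n\<^sup>2 \<le> (2 ^ k)\<^sup>2" by (rule power_mono) simp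
  then have m: "m \<le> 2 ^ (2 * k)" using En Em by (simp add: power_mult[symmetric] mult.commute)
  let ?P = "scheme_primes t n" and ?N = "2 ^ (2 * prime_bits t n)" and ?K = "scheme_base t n"
  let ?L = "8 * levels n" and ?b = "6 * Suc t"
  have H: "hierarchy E ?b ?L E"
  proof -
    \<comment> \<open>There are at most \<open>2 ^ (2 * k)\<close> edges, and \<open>4 * k\<close>
      rounds reduce them to single edges because \<open>2 ^ 6 = 64\<close> is at most
      \<open>3 ^ 4 = 81\<close>. Each round has two splits, which gives the \<open>8 * k\<close>
      levels.\<close>
    have "2 ^ (4 * k) * card E \<le> 2 ^ (4 * k) * 2 ^ (2 * k)" using m Em by simp
    also have "\<dots> = (2 ^ 6) ^ k" by (simp only: power_add[symmetric] power_mult[symmetric]) simp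
    also have "\<dots> \<le> (3 ^ 4) ^ k" by (intro power_mono) auto
    also have "\<dots> = 3 ^ (4 * k)" by (simp only: power_mult)
    finally show ?thesis
      using tree_decomposition_hierarchy[OF G Vne tw, of "4 * k"] unfolding k_def by simp
  qed
  have large: "2 * ?L * (2 ^ ?L * 6 ^ (4 * ?b) * Suc m) \<le> card ?P"
  proof -
    have "k \<le> 2 ^ k" by (rule less_imp_le[OF less_exp])
    then have 1: "2 * (8 * k) \<le> 2 ^ (k + 4)" by (simp add: power_add)
    have "(6::nat) ^ (4 * ?b) \<le> (2 ^ 3) ^ (4 * ?b)" by (intro power_mono) auto
    also have "\<dots> = 2 ^ (72 * Suc t)" by (simp only: power_mult[symmetric]) simp
    finally have 2: "(6::nat) ^ (4 * ?b) \<le> 2 ^ (72 * Suc t)" .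
    have "(1::nat) \<le> 2 ^ (2 * k)" by simp
    then have "Suc m \<le> 2 ^ (2 * k) + 2 ^ (2 * k)" using m by linarith
    then have 3: "Suc m \<le> 2 ^ (2 * k + 1)" by simp
    have "2 * (8 * k) * (2 ^ (8 * k) * 6 ^ (4 * ?b) * Suc m)
      \<le> 2 ^ (k + 4) * (2 ^ (8 * k) * 2 ^ (72 * Suc t) * 2 ^ (2 * k + 1))"
      by (intro mult_le_mono 1 2 3 order_refl)
    also have "\<dots> = 2 ^ prime_bits t n"
      unfolding prime_bits_def k_def by (simp only: power_add[symmetric]) (simp add: algebra_simps)
    also have "\<dots> \<le> card ?P" by (rule scheme_primes(3))
    finally show ?thesis unfolding k_def .
  qed
  have "card E * ?N \<le> 2 ^ (2 * k) * ?N" using m Em by simp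
  also have "\<dots> < ?K" unfolding scheme_base_def k_def by (simp add: power_add)
  finally have K: "card E * ?N < ?K" .
  have \<phi>: "inj_on \<phi> E" "\<phi> ` E \<subseteq> {..m}" using bij unfolding bij_betw_def by auto
  let ?good = "\<lambda>ps. isolates (hash_weight ?K ps \<circ> \<phi>) (HC V E)"
  let ?ls = "List.n_lists ?L (sorted_list_of_set ?P)"
  have scheme: "scheme t n m = map (hash_weight ?K) ?ls"
    using n3 En Em unfolding scheme_def by simp
  have dist: "distinct ?ls" by (intro distinct_n_lists) simp
  have "length (filter ?good ?ls) = card (set (filter ?good ?ls))"
    by (rule distinct_card[symmetric]) (rule distinct_filter[OF dist])
  also have "set (filter ?good ?ls) = {ps. set ps \<subseteq> ?P \<and> length ps = ?L \<and> ?good ps}"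
    using scheme_primes(1) by (auto simp: set_n_lists)
  finally have "card ?P ^ ?L \<le> 2 * length (filter ?good ?ls)"
    using half_of_hash_weights_isolate[OF G finE \<phi> scheme_primes(1) scheme_primes(2) K H large ne]
    by (simp only:)
  then show ?thesis unfolding scheme by (simp add: filter_map comp_def length_n_lists)
qed

lemma scheme_bounds:
  fixes n t m :: nat
  assumes "1 \<le> n"
  defines "B \<equiv> 4000 * (real t * log 2 (real n) + (log 2 (real n))\<^sup>2)"
  shows "scheme t n m \<noteq> []" "random_bits (scheme t n m) \<le> B"
    and "\<omega> \<in> set (scheme t n m) \<Longrightarrow> real (\<omega> e) \<le> 2 powr B"
proof -
  let ?l = "log 2 (real n)"
  let ?P = "scheme_primes t n" and ?K = "scheme_base t n" and ?L = "8 * levels n"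
  have l0: "0 \<le> ?l" using assms by simp
  then have B0: "0 \<le> B" unfolding B_def by simp
  have P0: "0 < card ?P" using scheme_primes(3)[of t n] by (meson less_le_trans pos2 zero_less_power)
  \<comment> \<open>The product of the bits per digit and the number of digits bounds the logarithm
    of the weights, and also the number of random bits, since a prime has fewer bits than a
    digit.\<close>
  have bound: "real ((2 * levels n + 2 * prime_bits t n + 1) * ?L) \<le> B" if "3 \<le> n"
  proof -
    have l1: "1 \<le> ?l" using that by (subst le_log_iff) auto
    have k: "real (levels n) \<le> 2 * ?l" using that by (intro levels_le) simp
    have "real (2 * levels n + 2 * prime_bits t n + 1) = 24 * real (levels n) + 144 * real t + 155"
      unfolding prime_bits_def by simp
    \<comment> \<open>As \<open>levels n\<close> is at most \<open>2 * log 2 n\<close> and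
      \<open>log 2 n\<close> is at least 1, the coefficient is \<open>24 * 2 + 155 = 203\<close>.
      The factor \<open>16 * log 2 n\<close> for the levels turns 203 and 144 into 3248 and 2304,
      both below 4000.\<close>
    also have "\<dots> \<le> 203 * ?l + 144 * real t" using k l1 by simp
    finally have "real (2 * levels n + 2 * prime_bits t n + 1) * real ?L
        \<le> (203 * ?l + 144 * real t) * (16 * ?l)"
      using k l1 by (intro mult_mono) auto
    also have "\<dots> = 3248 * ?l\<^sup>2 + 2304 * (real t * ?l)" by (simp add: algebra_simps power2_eq_square)
    also have "\<dots> \<le> B" unfolding B_def using l0 by (simp add: distrib_left)
    finally show ?thesis by (simp only: of_nat_mult)
  qed
  show "scheme t n m \<noteq> []"
  proof -
    have "length (List.n_lists ?L (sorted_list_of_set ?P)) \<noteq> 0"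
      using P0 scheme_primes(1) by (auto simp: length_n_lists)
    then show ?thesis unfolding scheme_def by auto
  qed
  show "random_bits (scheme t n m) \<le> B"
  proof (cases "3 \<le> n \<and> m \<le> n\<^sup>2")
    case True
    have "real (length (scheme t n m)) = real (card ?P) ^ ?L"
      using True scheme_primes(1) unfolding scheme_def by (simp add: length_n_lists)
    then have "random_bits (scheme t n m) = real ?L * log 2 (real (card ?P))"
      unfolding random_bits_def using P0 by (simp add: log_nat_power)
    also have "\<dots> \<le> real ?L * real (2 * prime_bits t n)"
    proof (intro mult_left_mono)
      have "real (card ?P) \<le> 2 ^ (2 * prime_bits t n)"
        using scheme_primes(4)[of t n] by (metis of_nat_le_iff of_nat_numeral of_nat_power)
      then show "log 2 (real (card ?P)) \<le> real (2 * prime_bits t n)"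
        using P0 by (subst log_le_iff) (auto simp: powr_realpow[symmetric])
    qed simp
    also have "\<dots> \<le> real ((2 * levels n + 2 * prime_bits t n + 1) * ?L)"
      by (simp add: algebra_simps)
    also have "\<dots> \<le> B" using bound True by simp
    finally show ?thesis .
  next
    case False
    then have "scheme t n m = [\<lambda>_. 0]" unfolding scheme_def by auto
    then show ?thesis using B0 unfolding random_bits_def by simp
  qed
  show "real (\<omega> e) \<le> 2 powr B" if \<omega>: "\<omega> \<in> set (scheme t n m)"
  proof (cases "3 \<le> n \<and> m \<le> n\<^sup>2")
    case True
    then obtain ps where ps: "\<omega> = hash_weight ?K ps" "length ps = ?L" "set ps \<subseteq> ?P"
      using \<omega> scheme_primes(1) unfolding scheme_def by (auto simp: set_n_lists)
    have "(2::nat) ^ (2 * prime_bits t n) \<le> ?K" unfolding scheme_base_def by (intro power_increasing) auto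
    then have "\<forall>p\<in>set ps. 0 < p \<and> p \<le> ?K"
      using ps(3) scheme_primes(2) by (meson order_trans prime_gt_0_nat subsetD)
    then have "\<omega> e < ?K ^ ?L" using hash_weight_less[of ps ?K e] ps by simp
    also have "\<dots> = 2 ^ ((2 * levels n + 2 * prime_bits t n + 1) * ?L)"
      unfolding scheme_base_def by (simp only: power_mult)
    finally have "real (\<omega> e) \<le> 2 ^ ((2 * levels n + 2 * prime_bits t n + 1) * ?L)"
      by (metis less_imp_le of_nat_le_iff of_nat_numeral of_nat_power)
    also have "\<dots> = 2 powr real ((2 * levels n + 2 * prime_bits t n + 1) * ?L)"
      by (subst powr_realpow) auto
    also have "\<dots> \<le> 2 powr B" using bound True by (intro powr_mono) auto
    finally show ?thesis .
  next
    case False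
    then have "\<omega> = (\<lambda>_. 0)" using \<omega> unfolding scheme_def by auto
    then show ?thesis by simp
  qed
qed

theorem theorem1p2:
  "\<exists>c::real. \<forall>t::nat. \<exists>W.
     isolation_scheme_HC (\<lambda>V E. treewidth V E \<le> t) W \<and>
     (\<forall>n\<ge>1. \<forall>m.
        random_bits (W n m) \<le> c * (real t * log 2 (real n) + (log 2 (real n))\<^sup>2) \<and>
        (\<forall>\<omega>\<in>set (W n m). \<forall>k\<in>{1..m}.
           real (\<omega> k) \<le> 2 powr (c * (real t * log 2 (real n) + (log 2 (real n))\<^sup>2))))"
proof (intro exI[of _ 4000] allI)
  fix t :: nat
  have "scheme t n m \<noteq> []" for n m
    using scheme_bounds(1)[of n t m] unfolding scheme_def by (cases "1 \<le> n") auto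
  then have "isolation_scheme_HC (\<lambda>V E. treewidth V E \<le> t) (scheme t)"
    unfolding isolation_scheme_HC_def using scheme_isolates by blast
  then show "\<exists>W. isolation_scheme_HC (\<lambda>V E. treewidth V E \<le> t) W \<and>
     (\<forall>n\<ge>1. \<forall>m.
        random_bits (W n m) \<le> 4000 * (real t * log 2 (real n) + (log 2 (real n))\<^sup>2) \<and>
        (\<forall>\<omega>\<in>set (W n m). \<forall>k\<in>{1..m}.
           real (\<omega> k) \<le> 2 powr (4000 * (real t * log 2 (real n) + (log 2 (real n))\<^sup>2))))"
    using scheme_bounds(2,3) by (intro exI[of _ "scheme t"]) blast
qed

end
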